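(* Let $\mathcal{A} = (Q, q_{\mathsf{init}}, \Sigma, \Gamma, \delta^o, \delta^t)$ be a counter-free transducer. Let $x \in \Sigma^\omega$ be uniformly recurrent and admit factor frequencies. If $\mathcal{A}(x)$ is an infinite word, then it has a suffix $y$ which is uniformly recurrent and admits factor frequencies. When moreover $x$ is effectively uniformly recurrent and admits computable factor frequencies, the suffix $y$ is also effectively uniformly recurrent and admits computable factor frequencies, and its starting index in $\mathcal{A}(x)$ can be computed.
   Context: All alphabets are finite and non-empty. Words are indexed from $0$; $x(n)$ is the $n$-th letter, $x(i,j)$ the factor at positions $i,\dots,j-1$. Transducer (deterministic): $Q$ finite non-empty set of states, $q_{\mathsf{init}}\in Q$, $\delta^t\colon Q\times\Sigma\to Q$ the transition function, $\delta^o\colon Q\times\Sigma\to\Gamma^*$ the output function; $\mathcal{A}(x)=\delta^o(q_0,x(0))\,\delta^o(q_1,x(1))\cdots$ where $q_0=q_{\mathsf{init}}$, $q_{n+1}=\delta^t(q_n,x(n))$. For $u\in\Sigma^*$ let $\delta_u\colon Q\to Q$ be the state transformation induced by reading $u$. The transducer is counter-free if there are no $u\in\Sigma^+$ and $Q'\subseteq Q$ such that $\delta_u$ induces a non-trivial permutation on $Q'$. Recurrence: $x$ is recurrent if every factor occurs infinitely often. A return word to a factor $u$ is a word $r$ such that $ru$ is a factor of $x$ containing exactly two occurrences of $u$, one as prefix and one as suffix. A recurrent word is uniformly recurrent if every factor has finitely many return words; $R_x(n)$ is the length of the longest return word to a length-$n$ factor. It is effectively uniformly recurrent if $n\mapsto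 x(n)$ and $n\mapsto R_x(n)$ are computable. Frequencies: $f_x(u)=\lim_{N\to\infty}\frac1N|\{i<N : x(i,i+|u|)=u\}|$. The word $x$ admits factor frequencies if this limit exists for every factor $u$ occurring infinitely often in $x$. It admits computable factor frequencies if moreover there is a Turing machine which, given a factor $u$ and a tolerance $\delta>0$, computes a rational $\rho$ with $|f_x(u)-\rho|<\delta$. "Can be computed" means computed from $\mathcal{A}$ and the algorithms witnessing effectiveness for $x$. *)

theory Defs
  imports Complex_Main "HOL-Library.Omega_Words_Fun" "HOL-Library.Nat_Bijection"
begin

section \<open>Infinite words: recurrence and factor frequencies\<close>

definition occurs_at :: "'a word \<Rightarrow> 'a list \<Rightarrow> nat \<Rightarrow> bool" where
  "occurs_at x u i \<longleftrightarrow> x [i \<rightarrow> i + length u] = u"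

definition factor :: "'a word \<Rightarrow> 'a list \<Rightarrow> bool" where
  "factor x u \<longleftrightarrow> (\<exists>i. occurs_at x u i)"

definition recurrent :: "'a word \<Rightarrow> bool" where
  "recurrent x \<longleftrightarrow> (\<forall>u. factor x u \<longrightarrow> infinite {i. occurs_at x u i})"

definition occurrences :: "'a list \<Rightarrow> 'a list \<Rightarrow> nat set" where
  "occurrences u w = {i. i + length u \<le> length w \<and> take (length u) (drop i w) = u}"

definition return_word :: "'a word \<Rightarrow> 'a list \<Rightarrow> 'a list \<Rightarrow> bool" where
  "return_word x u r \<longleftrightarrow>
     factor x (r @ u) \<and> card (occurrences u (r @ u)) = 2 \<and>
     0 \<in> occurrences u (r @ u) \<and> length r \<in> occurrences u (r @ u)"

definition uniformly_recurrent :: "'a word \<Rightarrow> bool" where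
  "uniformly_recurrent x \<longleftrightarrow>
     recurrent x \<and> (\<forall>u. factor x u \<longrightarrow> finite {r. return_word x u r})"

text \<open>For a uniformly recurrent word over a finite alphabet the maximum below ranges over a
  finite non-empty set.\<close>

definition max_return :: "'a word \<Rightarrow> nat \<Rightarrow> nat" where
  "max_return x n = Max {length r |u r. factor x u \<and> length u = n \<and> return_word x u r}"

definition emp_freq :: "'a word \<Rightarrow> 'a list \<Rightarrow> nat \<Rightarrow> real" where
  "emp_freq x u N = real (card {i. i < N \<and> occurs_at x u i}) / real N"

definition freq :: "'a word \<Rightarrow> 'a list \<Rightarrow> real" where
  "freq x u = lim (emp_freq x u)"

definition admits_freqs :: "'a word \<Rightarrow> bool" where
  "admits_freqs x \<longleftrightarrow>
     (\<forall>u. infinite {i. occurs_at x u i} \<longrightarrow> convergent (emp_freq x u))"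


section \<open>Transducers\<close>

record ('q, 'a, 'b) transducer =
  states :: "'q set"
  initial :: 'q
  in_alph :: "'a set"
  out_alph :: "'b set"
  out_fun :: "'q \<Rightarrow> 'a \<Rightarrow> 'b list"
  trans_fun :: "'q \<Rightarrow> 'a \<Rightarrow> 'q"

definition wf_transducer :: "('q, 'a, 'b) transducer \<Rightarrow> bool" where
  "wf_transducer A \<longleftrightarrow>
     finite (states A) \<and> initial A \<in> states A \<and>
     finite (in_alph A) \<and> in_alph A \<noteq> {} \<and>
     finite (out_alph A) \<and> out_alph A \<noteq> {} \<and>
     (\<forall>q\<in>states A. \<forall>a\<in>in_alph A.
        trans_fun A q a \<in> states A \<and> set (out_fun A q a) \<subseteq> out_alph A)"

definition trans_word :: "('q, 'a, 'b) transducer \<Rightarrow> 'a list \<Rightarrow> 'q \<Rightarrow> 'q" where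
  "trans_word A u q = foldl (trans_fun A) q u"

definition counter_free :: "('q, 'a, 'b) transducer \<Rightarrow> bool" where
  "counter_free A \<longleftrightarrow>
     \<not> (\<exists>u Q'. u \<noteq> [] \<and> set u \<subseteq> in_alph A \<and> Q' \<subseteq> states A \<and>
           bij_betw (trans_word A u) Q' Q' \<and> (\<exists>q\<in>Q'. trans_word A u q \<noteq> q))"

primrec run :: "('q, 'a, 'b) transducer \<Rightarrow> 'a word \<Rightarrow> nat \<Rightarrow> 'q" where
  "run A x 0 = initial A"
| "run A x (Suc n) = trans_fun A (run A x n) (x n)"

definition out_prefix :: "('q, 'a, 'b) transducer \<Rightarrow> 'a word \<Rightarrow> nat \<Rightarrow> 'b list" where
  "out_prefix A x n = concat (map (\<lambda>i. out_fun A (run A x i) (x i)) [0..<n])"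

definition output_infinite :: "('q, 'a, 'b) transducer \<Rightarrow> 'a word \<Rightarrow> bool" where
  "output_infinite A x \<longleftrightarrow> (\<forall>m. \<exists>n. m < length (out_prefix A x n))"

text \<open>The infinite word having all \<^term>\<open>out_prefix A x n\<close> as prefixes; only meaningful if
  \<^term>\<open>output_infinite A x\<close>.\<close>

definition output_word :: "('q, 'a, 'b) transducer \<Rightarrow> 'a word \<Rightarrow> 'b word" where
  "output_word A x m = out_prefix A x (LEAST n. m < length (out_prefix A x n)) ! m"


section \<open>Computability\<close>

text \<open>Algorithms are programs for partial recursive functions. Programs are syntactic objects,
  so that they can in turn be given (via \<open>prog_code\<close>) as inputs to other programs.\<close>

datatype prog =
    Zero
  | Succ
  | Proj nat
  | Comp prog "prog list"
  | PrimRec prog prog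
  | Mu prog

text \<open>\<open>eval p xs y\<close>: program \<open>p\<close> halts on input \<open>xs\<close> with output \<open>y\<close>.\<close>

inductive eval :: "prog \<Rightarrow> nat list \<Rightarrow> nat \<Rightarrow> bool" where
  Zero: "eval Zero xs 0"
| Succ: "eval Succ [n] (Suc n)"
| Proj: "i < length xs \<Longrightarrow> eval (Proj i) xs (xs ! i)"
| Comp: "list_all2 (\<lambda>g y. eval g xs y) gs ys \<Longrightarrow> eval f ys z \<Longrightarrow> eval (Comp f gs) xs z"
| PrimRec_0: "eval f xs y \<Longrightarrow> eval (PrimRec f g) (0 # xs) y"
| PrimRec_Suc: "eval (PrimRec f g) (n # xs) y \<Longrightarrow> eval g (n # y # xs) z \<Longrightarrow>
    eval (PrimRec f g) (Suc n # xs) z"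
| Mu: "eval f (n # xs) 0 \<Longrightarrow> (\<And>m. m < n \<Longrightarrow> \<exists>y. eval f (m # xs) (Suc y)) \<Longrightarrow>
    eval (Mu f) xs n"

inductive_cases eval_ZeroE: "eval Zero xs y"
inductive_cases eval_SuccE: "eval Succ xs y"
inductive_cases eval_ProjE: "eval (Proj i) xs y"
inductive_cases eval_CompE: "eval (Comp f gs) xs y"
inductive_cases eval_PrimRec_0E: "eval (PrimRec f g) (0 # xs) y"
inductive_cases eval_PrimRec_SucE: "eval (PrimRec f g) (Suc n # xs) y"
inductive_cases eval_MuE: "eval (Mu f) xs y"

lemma eval_deterministic: "eval p xs y \<Longrightarrow> eval p xs z \<Longrightarrow> y = z"
proof (induction arbitrary: z rule: eval.induct)
  case (Zero xs)
  then show ?case by (rule eval_ZeroE) simp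
next
  case (Succ n)
  then show ?case by (rule eval_SuccE) simp
next
  case (Proj i xs)
  from Proj.prems show ?case by (rule eval_ProjE) simp
next
  case (Comp xs gs ys f w)
  from Comp.prems obtain ys' where ys': "list_all2 (\<lambda>g y. eval g xs y) gs ys'" "eval f ys' z"
    by (rule eval_CompE)
  have "ys = ys'"
  proof (rule nth_equalityI)
    show len: "length ys = length ys'"
      using list_all2_lengthD[OF Comp.IH(1)] list_all2_lengthD[OF ys'(1)] by simp
    fix i assume "i < length ys"
    then have i: "i < length ys'" using len by simp
    show "ys ! i = ys' ! i"
      using list_all2_nthD2[OF Comp.IH(1) \<open>i < length ys\<close>, THEN conjunct2, rule_format]
        list_all2_nthD2[OF ys'(1) i] .
  qed
  with ys'(2) have "eval f ys z" by simp
  then show ?case by (rule Comp.IH(2))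
next
  case (PrimRec_0 f xs y g)
  from PrimRec_0.prems have "eval f xs z" by (rule eval_PrimRec_0E)
  then show ?case by (rule PrimRec_0.IH)
next
  case (PrimRec_Suc f g n xs y w)
  from PrimRec_Suc.prems obtain y'
    where y': "eval (PrimRec f g) (n # xs) y'" "eval g (n # y' # xs) z"
    by (rule eval_PrimRec_SucE)
  from PrimRec_Suc.IH(1)[OF y'(1)] y'(2) have "eval g (n # y # xs) z" by simp
  then show ?case by (rule PrimRec_Suc.IH(2))
next
  case (Mu f n xs)
  from Mu.prems have z: "eval f (z # xs) 0 \<and> (\<forall>m<z. \<exists>y. eval f (m # xs) (Suc y))"
    by (rule eval_MuE) iprover
  show ?case
  proof (cases n z rule: linorder_cases)
    case less
    with z obtain y where "eval f (n # xs) (Suc y)" by iprover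
    from Mu.IH(1)[OF this] show ?thesis by simp
  next
    case equal
    then show ?thesis .
  next
    case greater
    from Mu.IH(2)[OF this] obtain y where y: "\<forall>v. eval f (z # xs) v \<longrightarrow> Suc y = v" by iprover
    from z have "eval f (z # xs) 0" ..
    with y have "Suc y = 0" by iprover
    then show ?thesis by simp
  qed
qed

fun prog_code :: "prog \<Rightarrow> nat" where
  "prog_code Zero = prod_encode (0, 0)"
| "prog_code Succ = prod_encode (1, 0)"
| "prog_code (Proj i) = prod_encode (2, i)"
| "prog_code (Comp f gs) =
     prod_encode (3, prod_encode (prog_code f, list_encode (map prog_code gs)))"
| "prog_code (PrimRec f g) = prod_encode (4, prod_encode (prog_code f, prog_code g))"
| "prog_code (Mu f) = prod_encode (5, prog_code f)"

text \<open>Every natural number represents a rational, and every rational is represented; the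
  representation need not be in lowest terms.\<close>

definition rat_of_code :: "nat \<Rightarrow> rat" where
  "rat_of_code c = (case prod_decode c of (a, b) \<Rightarrow> of_int (int_decode a) / of_nat (Suc b))"

text \<open>A transducer whose states and letters are natural numbers is given to a program as the
  finite tables of its components. The tables range over states and letters in increasing
  order, with the state as the major index.\<close>

definition transducer_code :: "(nat, nat, nat) transducer \<Rightarrow> nat" where
  "transducer_code A =
     (let qs = sorted_list_of_set (states A); as = sorted_list_of_set (in_alph A) in
      list_encode
       [list_encode qs,
        initial A,
        list_encode as,
        list_encode (sorted_list_of_set (out_alph A)),
        list_encode [list_encode (out_fun A q a). q \<leftarrow> qs, a \<leftarrow> as],
        list_encode [trans_fun A q a. q \<leftarrow> qs, a \<leftarrow> as]])"

definition computes :: "prog \<Rightarrow> (nat \<Rightarrow> nat) \<Rightarrow> bool" where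
  "computes p f \<longleftrightarrow> (\<forall>n. eval p [n] (f n))"

text \<open>On input a factor and a positive rational tolerance; nothing is required of the program on
  other inputs.\<close>

definition computes_freqs :: "prog \<Rightarrow> nat word \<Rightarrow> bool" where
  "computes_freqs p x \<longleftrightarrow>
     (\<forall>u d. infinite {i. occurs_at x u i} \<and> rat_of_code d > 0 \<longrightarrow>
        (\<exists>r. eval p [list_encode u, d] r \<and>
             \<bar>freq x u - of_rat (rat_of_code r)\<bar> < of_rat (rat_of_code d)))"

definition effectively_uniformly_recurrent :: "nat word \<Rightarrow> bool" where
  "effectively_uniformly_recurrent x \<longleftrightarrow>
     uniformly_recurrent x \<and> (\<exists>p. computes p x) \<and> (\<exists>p. computes p (max_return x))"

definition admits_computable_freqs :: "nat word \<Rightarrow> bool" where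
  "admits_computable_freqs x \<longleftrightarrow> admits_freqs x \<and> (\<exists>p. computes_freqs p x)"

end

theory Submission
  imports Defs
begin

text \<open>Among the factors of \<open>x\<close> choose \<open>u\<close> whose state transformation has minimal rank. A word leading
  from one occurrence of \<open>u\<close> to another permutes the image of that transformation, so by
  counter-freeness it fixes the image pointwise; hence the transducer is in the same state after
  every occurrence of \<open>u\<close>. Since \<open>u\<close> occurs with bounded gaps, the output from the first occurrence
  on is a sliding block code of \<open>x\<close> (with output blocks of varying length), and it inherits uniform
  recurrence and, as a quotient of two averages over \<open>x\<close>, the existence of frequencies.

  That \<open>u\<close> synchronizes can be verified on a prefix of \<open>x\<close> whose length is given by the return
  function, so the starting index is found by unbounded search, through pairs of a candidate and a
  list of evaluation steps for the given programs; the latter takes the place of a universal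
  program. The programs for the suffix need not be uniform, so they may contain all the constants
  as well as finite tables for the transducer.\<close>

section \<open>Programs for pairing\<close>

text \<open>Minimality of the rank serves only to guarantee that a synchronizing factor exists. The
  search does not compute ranks: it accepts any factor that passes a finite check of the states
  reached after its early occurrences. The check is conclusive because a window holding two nearby
  occurrences of the factor recurs near the beginning of \<open>x\<close>, so that a state common to
  the early occurrences propagates to all later ones.

  Output blocks may be empty, so a bounded piece of output need not come from a bounded piece of
  input. Synchronization repairs this: a window with \<open>u\<close> followed by a productive
  letter recurs with the same output, which bounds the wait for the next output symbol. The
  resulting constant \<open>K\<close> governs the window lengths and makes the mean output per
  letter, \<open>rate []\<close>, positive; the frequency of \<open>v\<close> is then
  \<open>rate v / rate []\<close>.\<close>

lemma eval_Proj: "i < length xs \<Longrightarrow> xs ! i = v \<Longrightarrow> eval (Proj i) xs v"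
  using eval.Proj by auto

lemma eval_Comp1: "eval g xs y \<Longrightarrow> eval f [y] z \<Longrightarrow> eval (Comp f [g]) xs z"
  by (rule eval.Comp[where ys = "[y]"]) auto

lemma eval_Comp2: "eval g xs y \<Longrightarrow> eval h xs y' \<Longrightarrow> eval f [y, y'] z \<Longrightarrow> eval (Comp f [g, h]) xs z"
  by (rule eval.Comp[where ys = "[y, y']"]) auto

lemma eval_Succ: "v = Suc n \<Longrightarrow> eval Succ [n] v"
  using eval.Succ by simp

definition Add_prog :: prog where
  "Add_prog = PrimRec (Proj 0) (Comp Succ [Proj 1])"

lemma eval_Add_prog: "eval Add_prog [m, n] (m + n)"
  unfolding Add_prog_def
proof (induction m)
  case (Suc m)
  show ?case
    by (rule eval.PrimRec_Suc[OF Suc], rule eval_Comp1[OF eval_Proj eval_Succ]) auto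
qed (auto intro!: eval.PrimRec_0 eval_Proj)

definition Pred_prog :: prog where
  "Pred_prog = PrimRec Zero (Proj 0)"

lemma eval_Pred_prog: "eval Pred_prog [n] (n - 1)"
  unfolding Pred_prog_def
proof (induction n)
  case (Suc n)
  show ?case by (rule eval.PrimRec_Suc[OF Suc], rule eval_Proj) auto
qed (auto intro!: eval.PrimRec_0 eval.Zero)

text \<open>\<open>PrimRec\<close> recurses on the first argument, so the subtrahend comes
  first.\<close>

definition Sub_prog :: prog where
  "Sub_prog = PrimRec (Proj 0) (Comp Pred_prog [Proj 1])"

lemma eval_Sub_prog: "eval Sub_prog [n, m] (m - n)"
  unfolding Sub_prog_def
proof (induction n)
  case (Suc n)
  have "eval Pred_prog [m - n] (m - Suc n)" using eval_Pred_prog[of "m - n"] by simp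
  then show ?case by (intro eval.PrimRec_Suc[OF Suc] eval_Comp1[OF eval_Proj]) auto
qed (auto intro!: eval.PrimRec_0 eval_Proj)

definition Triangle_prog :: prog where
  "Triangle_prog = PrimRec Zero (Comp Add_prog [Proj 1, Comp Succ [Proj 0]])"

lemma eval_Triangle_prog: "eval Triangle_prog [n] (triangle n)"
  unfolding Triangle_prog_def
proof (induction n)
  case (Suc n)
  have "eval Add_prog [triangle n, Suc n] (triangle (Suc n))"
    using eval_Add_prog[of "triangle n" "Suc n"] by simp
  then show ?case
    by (intro eval.PrimRec_Suc[OF Suc] eval_Comp2 eval_Comp1 eval_Proj eval_Succ) auto
qed (auto intro!: eval.PrimRec_0 eval.Zero)

definition Pair_prog :: prog where
  "Pair_prog = Comp Add_prog [Comp Triangle_prog [Add_prog], Proj 0]"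

lemma eval_Pair_prog: "eval Pair_prog [a, b] (prod_encode (a, b))"
proof -
  have "eval Add_prog [triangle (a + b), a] (prod_encode (a, b))"
    using eval_Add_prog[of "triangle (a + b)" a] by (simp add: prod_encode_def)
  then show ?thesis unfolding Pair_prog_def
    by (intro eval_Comp2[OF eval_Comp1[OF eval_Add_prog eval_Triangle_prog] eval_Proj]) auto
qed

text \<open>The pair with code \<open>c\<close> has component sum \<open>diagonal c\<close>.\<close>

primrec diagonal :: "nat \<Rightarrow> nat" where
  "diagonal 0 = 0"
| "diagonal (Suc c) = diagonal c + (1 - (triangle (Suc (diagonal c)) - Suc c))"

text \<open>The truncated difference in the recursion vanishes exactly when \<open>Suc c\<close>
  reaches the next triangular number, which is when the diagonal has to advance.\<close>

lemma diagonal_bounds: "triangle (diagonal c) \<le> c \<and> c < triangle (Suc (diagonal c))"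
proof (induction c)
  case (Suc c)
  show ?case
  proof (cases "Suc c < triangle (Suc (diagonal c))")
    case True
    then have "diagonal (Suc c) = diagonal c" by simp
    with True Suc show ?thesis by simp
  next
    case False
    then have "Suc c = triangle (Suc (diagonal c))" using Suc by simp
    then have "diagonal (Suc c) = Suc (diagonal c)" by simp
    then show ?thesis using \<open>Suc c = triangle (Suc (diagonal c))\<close> by simp
  qed
qed simp

lemma triangle_mono: "m \<le> n \<Longrightarrow> triangle m \<le> triangle n"
  by (induction n) (auto simp: le_Suc_eq)

lemma diagonal_prod_encode: "diagonal (prod_encode (a, b)) = a + b"
proof -
  let ?c = "prod_encode (a, b)"
  have 1: "triangle (a + b) \<le> ?c" "?c < triangle (Suc (a + b))"
    by (auto simp: prod_encode_def)
  note 2 = diagonal_bounds[of ?c]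
  show ?thesis
  proof (rule ccontr)
    assume "diagonal ?c \<noteq> a + b"
    then consider "Suc (diagonal ?c) \<le> a + b" | "Suc (a + b) \<le> diagonal ?c" by linarith
    then show False
      by cases (use 1 2 triangle_mono in fastforce)+
  qed
qed

definition Diag_prog :: prog where
  "Diag_prog = PrimRec Zero (Comp Add_prog [Proj 1, Comp Sub_prog
     [Comp Sub_prog [Comp Succ [Proj 0], Comp Triangle_prog [Comp Succ [Proj 1]]], Comp Succ [Zero]]])"

lemma eval_Diag_prog: "eval Diag_prog [c] (diagonal c)"
  unfolding Diag_prog_def
proof (induction c)
  case (Suc c)
  have "eval Add_prog [diagonal c, 1 - (triangle (Suc (diagonal c)) - Suc c)] (diagonal (Suc c))"
    using eval_Add_prog[of "diagonal c" "1 - (triangle (Suc (diagonal c)) - Suc c)"] by simp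
  moreover have "eval Succ [0] 1" by (rule eval_Succ) simp
  ultimately show ?case
    by (intro eval.PrimRec_Suc[OF Suc])
      (rule eval_Comp2 eval_Comp1 eval_Sub_prog eval_Triangle_prog eval.Succ eval.Zero eval_Proj
        | assumption | simp)+
qed (auto intro!: eval.PrimRec_0 eval.Zero)

definition Fst_prog :: prog where
  "Fst_prog = Comp Sub_prog [Comp Triangle_prog [Diag_prog], Proj 0]"

definition Snd_prog :: prog where
  "Snd_prog = Comp Sub_prog [Fst_prog, Diag_prog]"

lemma eval_Fst_prog: "eval Fst_prog [prod_encode (a, b)] a"
proof -
  let ?c = "prod_encode (a, b)"
  have "eval Sub_prog [triangle (diagonal ?c), ?c] a"
    using eval_Sub_prog[of "triangle (diagonal ?c)" ?c]
    by (simp add: diagonal_prod_encode) (simp add: prod_encode_def)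
  then show ?thesis unfolding Fst_prog_def
    by (intro eval_Comp2[OF eval_Comp1[OF eval_Diag_prog eval_Triangle_prog] eval_Proj]) auto
qed

lemma eval_Snd_prog: "eval Snd_prog [prod_encode (a, b)] b"
proof -
  let ?c = "prod_encode (a, b)"
  have "eval Sub_prog [a, diagonal ?c] b"
    using eval_Sub_prog[of a "diagonal ?c"] by (simp add: diagonal_prod_encode)
  then show ?thesis unfolding Snd_prog_def
    by (intro eval_Comp2[OF eval_Fst_prog eval_Diag_prog])
qed


section \<open>Computable functions on encoded types\<close>

text \<open>With codes for pairs and lists, unary functions between encoded types suffice: several
  arguments are supplied as one tuple.\<close>

class enc =
  fixes enc :: "'a \<Rightarrow> nat"
  assumes inj_enc: "inj enc"

lemma enc_eq_iff [simp]: "enc (a :: 'a::enc) = enc b \<longleftrightarrow> a = b"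
  using inj_enc by (rule inj_eq)

instantiation nat :: enc
begin
definition "enc (n :: nat) = n"
instance by standard (simp add: enc_nat_def inj_def)
end

instantiation bool :: enc
begin
definition "enc b = (if b then 1 else 0 :: nat)"
instance by standard (simp add: enc_bool_def inj_def)
end

instantiation prod :: (enc, enc) enc
begin
definition "enc p = prod_encode (enc (fst p), enc (snd p))"
instance by standard (auto simp add: enc_prod_def inj_def prod_eq_iff)
end

instantiation list :: (enc) enc
begin
definition "enc xs = list_encode (map enc xs)"
instance by standard (simp add: enc_list_def inj_def list_encode_eq inj_map_eq_map[OF inj_enc])
end

lemma enc_nat_list: "enc (xs :: nat list) = list_encode xs"
  by (simp add: enc_list_def enc_nat_def map_idI)

text \<open>For unbounded search: if the codes exhaust the numbers, every number tried stands for a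
  candidate.\<close>

class enc_onto = enc +
  assumes surj_enc: "surj enc"

instance nat :: enc_onto
  by standard (auto simp: enc_nat_def surj_def)

instance prod :: (enc_onto, enc_onto) enc_onto
proof
  show "surj (enc :: 'a \<times> 'b \<Rightarrow> nat)"
    unfolding surj_def
  proof
    fix n
    obtain a where a: "enc (a::'a) = fst (prod_decode n)" using surj_enc by (metis surjD)
    obtain b where b: "enc (b::'b) = snd (prod_decode n)" using surj_enc by (metis surjD)
    have "enc (a, b) = n" by (simp add: enc_prod_def a b)
    then show "\<exists>p. n = enc (p :: 'a \<times> 'b)" by blast
  qed
qed

instance list :: (enc_onto) enc_onto
proof
  show "surj (enc :: 'a list \<Rightarrow> nat)"
    unfolding surj_def
  proof
    fix n
    have "map enc (map (inv (enc :: 'a \<Rightarrow> nat)) (list_decode n)) = list_decode n"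
      by (simp add: o_def surj_f_inv_f[OF surj_enc])
    then have "enc (map (inv (enc :: 'a \<Rightarrow> nat)) (list_decode n)) = n" 
      by (simp only: enc_list_def list_decode_inverse)
    then show "\<exists>p. n = enc (p :: 'a list)" by metis
  qed
qed

definition computable :: "('a::enc \<Rightarrow> 'b::enc) \<Rightarrow> bool" where
  "computable f \<longleftrightarrow> (\<exists>p. \<forall>a. eval p [enc a] (enc (f a)))"

lemma computableI: "(\<And>a. eval p [enc a] (enc (f a))) \<Longrightarrow> computable f"
  unfolding computable_def by blast

lemma computableE:
  assumes "computable f"
  obtains p where "\<And>a. eval p [enc a] (enc (f a))"
  using assms unfolding computable_def by blast

section \<open>Closure rules for computable functions\<close>

named_theorems computable_intros

lemma computable_id [computable_intros]: "computable (\<lambda>a. a)"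
  by (rule computableI[of "Proj 0"]) (auto intro: eval_Proj)

lemma computable_compose:
  assumes "computable f" "computable g"
  shows "computable (\<lambda>a. f (g a))"
proof -
  obtain p q where pq: "\<And>a. eval p [enc a] (enc (f a))" "\<And>a. eval q [enc a] (enc (g a))"
    using assms by (metis computableE)
  show ?thesis by (rule computableI[of "Comp p [q]"]) (rule eval_Comp1[OF pq(2) pq(1)])
qed

lemma eval_const: "\<exists>p. \<forall>xs. eval p xs n"
proof (induction n)
  case (Suc n)
  then obtain p where "\<forall>xs. eval p xs n" by blast
  then have "\<forall>xs. eval (Comp Succ [p]) xs (Suc n)" by (auto intro!: eval_Comp1 eval.Succ)
  then show ?case by blast
qed (use eval.Zero in blast)

lemma computable_const [computable_intros]: "computable (\<lambda>a. c)"
  using eval_const[of "enc c"] unfolding computable_def by auto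

lemma computable_Pair [computable_intros]:
  assumes "computable f" "computable g"
  shows "computable (\<lambda>a. (f a, g a))"
proof -
  obtain p q where pq: "\<And>a. eval p [enc a] (enc (f a))" "\<And>a. eval q [enc a] (enc (g a))"
    using assms by (metis computableE)
  show ?thesis
    by (rule computableI[of "Comp Pair_prog [p, q]"])
      (auto simp: enc_prod_def intro: eval_Comp2[OF pq] eval_Pair_prog)
qed

lemma computable_fst [computable_intros]: "computable f \<Longrightarrow> computable (\<lambda>a. fst (f a))"
  by (rule computable_compose[of fst], rule computableI[of Fst_prog])
    (auto simp: enc_prod_def eval_Fst_prog)

lemma computable_snd [computable_intros]: "computable f \<Longrightarrow> computable (\<lambda>a. snd (f a))"
  by (rule computable_compose[of snd], rule computableI[of Snd_prog])
    (auto simp: enc_prod_def eval_Snd_prog)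

lemma computable_Suc [computable_intros]: "computable f \<Longrightarrow> computable (\<lambda>a. Suc (f a))"
  by (rule computable_compose[of Suc], rule computableI[of Succ])
    (auto simp: enc_nat_def eval.Succ)

lemma computable_enc [computable_intros]: "computable f \<Longrightarrow> computable (\<lambda>a. enc (f a))"
  by (rule computable_compose[of enc], rule computableI[of "Proj 0"])
    (auto simp: enc_nat_def intro: eval_Proj)

lemma computable_prod_decode [computable_intros]:
  "computable f \<Longrightarrow> computable (\<lambda>a. prod_decode (f a))"
  by (rule computable_compose[of prod_decode], rule computableI[of "Proj 0"])
    (auto simp: enc_nat_def enc_prod_def intro: eval_Proj)

lemma computable_list_decode [computable_intros]:
  "computable f \<Longrightarrow> computable (\<lambda>a. list_decode (f a))"
  by (rule computable_compose[of list_decode], rule computableI[of "Proj 0"])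
    (auto simp: enc_nat_def enc_nat_list intro: eval_Proj)

lemma computable_prod_encode [computable_intros]:
  "computable f \<Longrightarrow> computable (\<lambda>a. prod_encode (f a))"
  using computable_enc[of f] by (simp add: enc_prod_def enc_nat_def)

text \<open>The hypothesis on \<open>g\<close> treats parameter, counter and accumulator as one
  tuple. With bound variables handled in this form, \<open>computable_intros\<close> can descend
  under binders and decompose a term by its syntax.\<close>

lemma computable_rec_nat [computable_intros]:
  assumes f: "computable f" and g: "computable (\<lambda>t. g (fst t) (fst (snd t)) (snd (snd t)))"
    and h: "computable h"
  shows "computable (\<lambda>a. rec_nat (f a) (\<lambda>n r. g a n r) (h a))"
proof -
  obtain pf where pf: "\<And>a. eval pf [enc a] (enc (f a))" using f by (rule computableE) blast
  obtain pg where pg: "\<And>a n r. eval pg [enc (a, n, r)] (enc (g a n r))" 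
    using g by (rule computableE) (metis fst_conv snd_conv)
  obtain ph where ph: "\<And>a. eval ph [enc a] (enc (h a))" using h by (rule computableE) blast
  \<comment> \<open>\<open>PrimRec\<close> supplies counter, accumulator and parameter in this
    order, while \<open>pg\<close> expects the parameter first.\<close>
  define step where "step = Comp pg [Comp Pair_prog [Proj 2, Comp Pair_prog [Proj 0, Proj 1]]]"
  have step: "eval step [n, enc r, enc a] (enc (g a n r))" for a n r
    unfolding step_def
    by (rule eval_Comp1[OF _ pg])
      (auto simp: enc_prod_def enc_nat_def intro!: eval_Comp2 eval_Proj eval_Pair_prog)
  have "eval (PrimRec pf step) [n, enc a] (enc (rec_nat (f a) (\<lambda>n r. g a n r) n))" for n a
    by (induction n) (auto intro: eval.PrimRec_0 eval.PrimRec_Suc pf step)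
  then show ?thesis
    by (intro computableI[of "Comp (PrimRec pf step) [ph, Proj 0]"] eval_Comp2[OF ph eval_Proj])
      (auto simp: enc_nat_def)
qed

text \<open>The program for \<open>g\<close> need only halt where the test succeeds.\<close>

lemma computable_if_lazy:
  assumes b: "computable b" and f: "computable f"
    and g: "\<And>a. b a \<Longrightarrow> eval p [enc a] (enc (g a))"
  shows "computable (\<lambda>a. if b a then g a else f a)"
proof -
  obtain pb where pb: "\<And>a. eval pb [enc a] (enc (b a))" using b by (rule computableE) blast
  obtain pf where pf: "\<And>a. eval pf [enc a] (enc (f a))" using f by (rule computableE) blast
  \<comment> \<open>Recursion on the 0/1 code of the test: \<open>p\<close> is evaluated only if the
    code is 1.\<close>
  let ?p = "PrimRec pf (Comp p [Proj 2])"
  have "eval ?p [0, enc a] (enc (f a))" for a by (intro eval.PrimRec_0 pf)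
  moreover have "eval ?p [Suc 0, enc a] (enc (g a))" if "b a" for a
    by (rule eval.PrimRec_Suc[OF eval.PrimRec_0[OF pf]], rule eval_Comp1[OF _ g[OF that]])
      (auto intro: eval_Proj)
  ultimately have p: "eval ?p [enc (b a), enc a] (enc (if b a then g a else f a))" for a
    by (auto simp: enc_bool_def)
  show ?thesis
    by (intro computableI[of "Comp ?p [pb, Proj 0]"] eval_Comp2[OF pb eval_Proj p]) simp_all
qed

lemma computable_if [computable_intros]:
  assumes "computable b" "computable f" "computable g"
  shows "computable (\<lambda>a. if b a then f a else g a)"
proof -
  obtain p where "\<And>a. eval p [enc a] (enc (f a))" using assms(2) by (rule computableE) blast
  then show ?thesis using computable_if_lazy[OF assms(1,3)] by blast
qed

section \<open>Arithmetic, connectives and comparisons\<close>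

lemma computable_pred [computable_intros]: "computable f \<Longrightarrow> computable (\<lambda>a. f a - Suc 0)"
  by (rule computable_compose[of "\<lambda>n. n - Suc 0"], rule computableI[of Pred_prog])
    (use eval_Pred_prog in \<open>auto simp: enc_nat_def\<close>)

lemma computable_diff [computable_intros]:
  assumes "computable f" "computable g"
  shows "computable (\<lambda>a. f a - g a :: nat)"
proof -
  obtain p q where pq: "\<And>a. eval p [enc a] (enc (f a))" "\<And>a. eval q [enc a] (enc (g a))"
    using assms by (metis computableE)
  show ?thesis
    by (rule computableI[of "Comp Sub_prog [q, p]"])
      (use eval_Sub_prog in \<open>auto simp: enc_nat_def intro!: eval_Comp2 pq[unfolded enc_nat_def]\<close>)
qed

lemma computable_cong: "computable g \<Longrightarrow> (\<And>a. f a = g a) \<Longrightarrow> computable f"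
  by (metis ext)

lemma computable_eq_0: "computable f \<Longrightarrow> computable (\<lambda>a. f a = (0::nat))"
proof -
  assume "computable f"
  then obtain p where p: "\<And>a. eval p [enc a] (f a)"
    by (rule computableE) (simp add: enc_nat_def, blast)
  obtain one where one: "\<And>xs. eval one xs 1" using eval_const by blast
  have "enc (f a = 0) = 1 - f a" for a by (simp add: enc_bool_def)
  then show ?thesis
    by (intro computableI[of "Comp Sub_prog [p, one]"], intro eval_Comp2[OF p one])
      (metis eval_Sub_prog)
qed

lemma computable_Not [computable_intros]: "computable b \<Longrightarrow> computable (\<lambda>a. \<not> b a)"
  by (rule computable_cong[of "\<lambda>a. if b a then False else True"]) (intro computable_intros, auto)

lemma computable_conj [computable_intros]:
  "computable b \<Longrightarrow> computable c \<Longrightarrow> computable (\<lambda>a. b a \<and> c a)"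
  by (rule computable_cong[of "\<lambda>a. if b a then c a else False"]) (intro computable_intros, auto)

lemma computable_disj [computable_intros]:
  "computable b \<Longrightarrow> computable c \<Longrightarrow> computable (\<lambda>a. b a \<or> c a)"
  by (rule computable_cong[of "\<lambda>a. if b a then True else c a"]) (intro computable_intros, auto)

lemma computable_imp [computable_intros]:
  "computable b \<Longrightarrow> computable c \<Longrightarrow> computable (\<lambda>a. b a \<longrightarrow> c a)"
  by (rule computable_cong[of "\<lambda>a. if b a then c a else True"]) (intro computable_intros, auto)

lemma computable_add [computable_intros]:
  assumes "computable f" "computable g"
  shows "computable (\<lambda>a. f a + g a :: nat)"
proof (rule computable_cong[of "\<lambda>a. rec_nat (f a) (\<lambda>n r. Suc r) (g a)"])
  show "computable (\<lambda>a. rec_nat (f a) (\<lambda>n r. Suc r) (g a))"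
    by (intro computable_intros assms)
  have "m + n = rec_nat m (\<lambda>n r. Suc r) n" for m n :: nat by (induction n) auto
  then show "f a + g a = rec_nat (f a) (\<lambda>n r. Suc r) (g a)" for a .
qed

lemma computable_mult [computable_intros]:
  assumes "computable f" "computable g"
  shows "computable (\<lambda>a. f a * g a :: nat)"
proof (rule computable_cong[of "\<lambda>a. rec_nat 0 (\<lambda>n r. r + f a) (g a)"])
  show "computable (\<lambda>a. rec_nat 0 (\<lambda>n r. r + f a) (g a))"
    by (intro computable_intros assms(2) computable_compose[OF assms(1)])
  have "m * n = rec_nat 0 (\<lambda>n r. r + m) n" for m n :: nat by (induction n) auto
  then show "f a * g a = rec_nat 0 (\<lambda>n r. r + f a) (g a)" for a .
qed

lemma computable_le [computable_intros]:
  assumes "computable f" "computable g"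
  shows "computable (\<lambda>a. f a \<le> (g a :: nat))"
  by (rule computable_cong[of "\<lambda>a. f a - g a = 0"]) (intro computable_eq_0 computable_intros assms, auto)

lemma computable_less [computable_intros]:
  assumes "computable f" "computable g"
  shows "computable (\<lambda>a. f a < (g a :: nat))"
  by (rule computable_cong[of "\<lambda>a. Suc (f a) \<le> g a"]) (intro computable_intros assms, auto)

lemma computable_eq [computable_intros]:
  assumes "computable f" "computable g"
  shows "computable (\<lambda>a. f a = g a)"
proof (rule computable_cong)
  show "computable (\<lambda>a. enc (f a) \<le> enc (g a) \<and> enc (g a) \<le> enc (f a))"
    by (intro computable_intros assms)
qed (auto simp: order.eq_iff[symmetric])

section \<open>Lists, bounded quantifiers and finite tables\<close>

lemma computable_case_list [computable_intros]:
  assumes f: "computable f" and g: "computable (\<lambda>t. g (fst t) (fst (snd t)) (snd (snd t)))"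
    and l: "computable l"
  shows "computable (\<lambda>a. case l a of [] \<Rightarrow> f a | x # xs \<Rightarrow> g a x xs)"
proof -
  obtain pg where pg: "\<And>a x xs. eval pg [enc (a, x, xs)] (enc (g a x xs))"
    using g by (rule computableE) (metis fst_conv snd_conv)
  obtain pl where pl: "\<And>a. eval pl [enc a] (enc (l a))" using l by (rule computableE) blast
  let ?g = "\<lambda>a. case l a of x # xs \<Rightarrow> g a x xs"
  \<comment> \<open>The code of \<open>x # xs\<close> is the successor of the code of the pair
    \<open>(x, xs)\<close>.\<close>
  have pred: "eval Pred_prog [enc (x # xs)] (enc (x, xs))" for x :: 'c and xs
    using eval_Pred_prog[of "enc (x # xs)"] by (simp add: enc_list_def enc_prod_def)
  have "computable (\<lambda>a. if l a \<noteq> [] then ?g a else f a)"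
  proof (rule computable_if_lazy)
    show "computable (\<lambda>a. l a \<noteq> [])" by (intro computable_intros l)
    fix a assume "l a \<noteq> []"
    then obtain x xs where la: "l a = x # xs" by (cases "l a") auto
    have 1: "eval (Comp Pred_prog [pl]) [enc a] (enc (x, xs))"
      using pl[of a] pred la by (auto intro: eval_Comp1)
    have "eval (Comp Pair_prog [Proj 0, Comp Pred_prog [pl]]) [enc a] (enc (a, x, xs))"
      by (rule eval_Comp2[OF eval_Proj 1]) (auto simp: enc_prod_def intro: eval_Pair_prog)
    from eval_Comp1[OF this pg]
    show "eval (Comp pg [Comp Pair_prog [Proj 0, Comp Pred_prog [pl]]]) [enc a] (enc (?g a))"
      by (simp add: la)
  qed (rule f)
  then show ?thesis by (rule computable_cong) (auto split: list.split)
qed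

lemma computable_Cons [computable_intros]:
  assumes "computable f" "computable g"
  shows "computable (\<lambda>a. f a # g a)"
proof (rule computable_compose[of "\<lambda>p. fst p # snd p" "\<lambda>a. (f a, g a)", simplified])
  show "computable (\<lambda>p :: 'b \<times> 'b list. fst p # snd p)"
    by (rule computableI[of Succ]) (auto simp: enc_list_def enc_prod_def intro: eval_Succ)
qed (intro computable_intros assms)

text \<open>Bounds a traversal: iterating as often as the code of the list says reaches its end, and
  the surplus iterations change nothing.\<close>

lemma length_le_enc: "length xs \<le> enc xs"
proof (induction xs)
  case (Cons x xs)
  have "enc xs \<le> prod_encode (enc x, enc xs)" by (rule le_prod_encode_2)
  with Cons show ?case by (simp add: enc_list_def)
qed simp

lemma computable_foldl [computable_intros]:
  assumes g: "computable (\<lambda>t. g (fst t) (fst (snd t)) (snd (snd t)))"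
    and i: "computable i" and l: "computable l"
  shows "computable (\<lambda>a. foldl (\<lambda>s x. g a s x) (i a) (l a))"
proof (rule computable_cong)
  let ?step = "\<lambda>a r. case fst r of [] \<Rightarrow> r | x # xs \<Rightarrow> (xs, g a (snd r) x)"
  show "computable (\<lambda>a. snd (rec_nat (l a, i a) (\<lambda>n r. ?step a r) (enc (l a))))"
    by (intro computable_intros i l) 
      (rule computable_compose[OF g, of "\<lambda>t. (fst (fst t), snd (snd (snd (fst t))), fst (snd t))", simplified],
        intro computable_intros)
  have "rec_nat (xs, s) (\<lambda>n r. ?step a r) n = (drop n xs, foldl (g a) s (take n xs))" for a xs s n
  proof (induction n)
    case (Suc n)
    show ?case
    proof (cases "drop n xs")
      case (Cons y ys)
      then have n: "n < length xs" by (cases "n < length xs") auto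
      then have "y = xs ! n" "ys = drop (Suc n) xs" using Cons Cons_nth_drop_Suc[OF n] by auto
      then show ?thesis using Suc Cons by (simp add: take_Suc_conv_app_nth[OF n])
    qed (use Suc in simp)
  qed simp
  then show "foldl (\<lambda>s x. g a s x) (i a) (l a) = snd (rec_nat (l a, i a) (\<lambda>n r. ?step a r) (enc (l a)))" for a
    using length_le_enc[of "l a"] by simp
qed

lemma computable_rev [computable_intros]:
  assumes "computable l"
  shows "computable (\<lambda>a. rev (l a))"
proof (rule computable_cong)
  show "computable (\<lambda>a. foldl (\<lambda>s x. x # s) [] (l a))" by (intro computable_intros assms)
  have "foldl (\<lambda>s x. x # s) ys xs = rev xs @ ys" for xs ys :: "'b list"
    by (induction xs arbitrary: ys) auto
  then show "rev (l a) = foldl (\<lambda>s x. x # s) [] (l a)" for a by simp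
qed

lemma computable_foldr [computable_intros]:
  assumes "computable (\<lambda>t. g (fst t) (fst (snd t)) (snd (snd t)))" "computable i" "computable l"
  shows "computable (\<lambda>a. foldr (\<lambda>x s. g a x s) (l a) (i a))"
  unfolding foldr_conv_foldl
  by (intro computable_intros assms(2,3)
    computable_compose[OF assms(1), of "\<lambda>t. (fst t, snd (snd t), fst (snd t))", simplified])

lemma computable_append [computable_intros]:
  assumes "computable f" "computable g"
  shows "computable (\<lambda>a. f a @ g a)"
proof (rule computable_cong)
  show "computable (\<lambda>a. foldr (\<lambda>x s. x # s) (f a) (g a))" by (intro computable_intros assms)
  have "xs @ ys = foldr (\<lambda>x s. x # s) xs ys" for xs ys :: "'b list" by (induction xs) auto
  then show "f a @ g a = foldr (\<lambda>x s. x # s) (f a) (g a)" for a .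
qed

lemma computable_map [computable_intros]:
  assumes g: "computable (\<lambda>t. g (fst t) (snd t))" and l: "computable l"
  shows "computable (\<lambda>a. map (\<lambda>x. g a x) (l a))"
proof (rule computable_cong)
  show "computable (\<lambda>a. foldr (\<lambda>x s. g a x # s) (l a) [])"
    by (intro computable_intros l
      computable_compose[OF g, of "\<lambda>t. (fst t, fst (snd t))", simplified])
  have "map h xs = foldr (\<lambda>x s. h x # s) xs []" for h :: "'b \<Rightarrow> 'c" and xs by (induction xs) auto
  then show "map (\<lambda>x. g a x) (l a) = foldr (\<lambda>x s. g a x # s) (l a) []" for a .
qed

lemma computable_filter [computable_intros]:
  assumes g: "computable (\<lambda>t. g (fst t) (snd t))" and l: "computable l"
  shows "computable (\<lambda>a. filter (\<lambda>x. g a x) (l a))"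
proof (rule computable_cong)
  show "computable (\<lambda>a. foldr (\<lambda>x s. if g a x then x # s else s) (l a) [])"
    by (intro computable_intros l
      computable_compose[OF g, of "\<lambda>t. (fst t, fst (snd t))", simplified])
  have "filter h xs = foldr (\<lambda>x s. if h x then x # s else s) xs []" for h :: "'b \<Rightarrow> bool" and xs
    by (induction xs) auto
  then show "filter (\<lambda>x. g a x) (l a) = foldr (\<lambda>x s. if g a x then x # s else s) (l a) []" for a .
qed

lemma computable_takeWhile [computable_intros]:
  assumes g: "computable (\<lambda>t. g (fst t) (snd t))" and l: "computable l"
  shows "computable (\<lambda>a. takeWhile (\<lambda>x. g a x) (l a))"
proof (rule computable_cong)
  show "computable (\<lambda>a. foldr (\<lambda>x s. if g a x then x # s else []) (l a) [])"
    by (intro computable_intros l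
      computable_compose[OF g, of "\<lambda>t. (fst t, fst (snd t))", simplified])
  have "takeWhile h xs = foldr (\<lambda>x s. if h x then x # s else []) xs []" for h :: "'b \<Rightarrow> bool" and xs
    by (induction xs) auto
  then show "takeWhile (\<lambda>x. g a x) (l a) = foldr (\<lambda>x s. if g a x then x # s else []) (l a) []" for a .
qed

lemma computable_concat [computable_intros]:
  assumes "computable l"
  shows "computable (\<lambda>a. concat (l a))"
proof (rule computable_cong)
  show "computable (\<lambda>a. foldr (\<lambda>x s. x @ s) (l a) [])" by (intro computable_intros assms)
  show "concat (l a) = foldr (\<lambda>x s. x @ s) (l a) []" for a by (simp add: concat_conv_foldr)
qed

lemma computable_Ball [computable_intros]:
  assumes g: "computable (\<lambda>t. g (fst t) (snd t))" and l: "computable l"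
  shows "computable (\<lambda>a. \<forall>x\<in>set (l a). g a x)"
  by (rule computable_cong[of "\<lambda>a. filter (\<lambda>x. \<not> g a x) (l a) = []"])
    (intro computable_intros l g, auto simp: filter_empty_conv)

lemma computable_Bex [computable_intros]:
  assumes g: "computable (\<lambda>t. g (fst t) (snd t))" and l: "computable l"
  shows "computable (\<lambda>a. \<exists>x\<in>set (l a). g a x)"
  by (rule computable_cong[of "\<lambda>a. filter (\<lambda>x. g a x) (l a) \<noteq> []"])
    (intro computable_intros l g, auto simp: filter_empty_conv)

lemma computable_member [computable_intros]:
  assumes "computable f" "computable l"
  shows "computable (\<lambda>a. f a \<in> set (l a))"
  by (rule computable_cong[of "\<lambda>a. \<exists>x\<in>set (l a). x = f a"])
    (intro computable_intros assms(2) computable_compose[OF assms(1)], auto)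

lemma computable_upt [computable_intros]:
  assumes "computable f" "computable g"
  shows "computable (\<lambda>a. [f a..<g a])"
proof (rule computable_cong)
  show "computable (\<lambda>a. rec_nat [] (\<lambda>n r. if f a \<le> n then r @ [n] else r) (g a))"
    by (intro computable_intros assms(2) computable_compose[OF assms(1)])
  have "[m..<n] = rec_nat [] (\<lambda>n r. if m \<le> n then r @ [n] else r) n" for m n
    by (induction n) auto
  then show "[f a..<g a] = rec_nat [] (\<lambda>n r. if f a \<le> n then r @ [n] else r) (g a)" for a .
qed

lemma computable_all_less [computable_intros]:
  fixes n :: "'a::enc \<Rightarrow> nat"
  assumes g: "computable (\<lambda>t. g (fst t) (snd t))" and n: "computable n"
  shows "computable (\<lambda>a. \<forall>k<n a. g a k)"
  by (rule computable_cong[of "\<lambda>a. \<forall>k\<in>set [0..<n a]. g a k"])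
    (intro computable_intros n g, auto)

lemma computable_sum_list [computable_intros]:
  assumes "computable l"
  shows "computable (\<lambda>a. sum_list (l a :: nat list))"
proof (rule computable_cong)
  show "computable (\<lambda>a. foldr (\<lambda>x s. x + s) (l a) 0)" by (intro computable_intros assms)
  show "sum_list (l a) = foldr (\<lambda>x s. x + s) (l a) 0" for a by (simp add: sum_list.eq_foldr)
qed

lemma computable_length [computable_intros]:
  assumes "computable l"
  shows "computable (\<lambda>a. length (l a))"
  by (rule computable_cong[of "\<lambda>a. sum_list (map (\<lambda>x. 1) (l a))"])
    (intro computable_intros assms, simp add: sum_list_triv)

lemma computable_tl [computable_intros]:
  assumes "computable l"
  shows "computable (\<lambda>a. tl (l a))"
  by (rule computable_cong[of "\<lambda>a. case l a of [] \<Rightarrow> [] | x # xs \<Rightarrow> xs"])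
    (intro computable_intros assms, simp split: list.split)

lemma computable_drop [computable_intros]:
  assumes "computable n" "computable l"
  shows "computable (\<lambda>a. drop (n a) (l a))"
proof (rule computable_cong)
  show "computable (\<lambda>a. rec_nat (l a) (\<lambda>n r. tl r) (n a))" by (intro computable_intros assms)
  have "drop n xs = rec_nat xs (\<lambda>n r. tl r) n" for n and xs :: "'b list"
    by (induction n) (auto simp: drop_Suc drop_tl)
  then show "drop (n a) (l a) = rec_nat (l a) (\<lambda>n r. tl r) (n a)" for a .
qed

lemma computable_take [computable_intros]:
  assumes "computable n" "computable l"
  shows "computable (\<lambda>a. take (n a) (l a))"
proof (rule computable_cong)
  show "computable (\<lambda>a. rev (drop (length (l a) - n a) (rev (l a))))"
    by (intro computable_intros assms)
  show "take (n a) (l a) = rev (drop (length (l a) - n a) (rev (l a)))" for a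
    by (cases "n a \<le> length (l a)") (simp_all add: drop_rev)
qed

text \<open>The default value makes up for the unspecified value of \<^const>\<open>nth\<close> out of range.\<close>

lemma computable_nth [computable_intros]:
  assumes "computable n" "computable l" "computable d"
  shows "computable (\<lambda>a. if n a < length (l a) then l a ! n a else d a)"
proof (rule computable_cong[of "\<lambda>a. case drop (n a) (l a) of [] \<Rightarrow> d a | x # xs \<Rightarrow> x"])
  show "(if n a < length (l a) then l a ! n a else d a) = (case drop (n a) (l a) of [] \<Rightarrow> d a | x # xs \<Rightarrow> x)" for a
    by (cases "n a < length (l a)") (simp_all add: Cons_nth_drop_Suc[symmetric])
qed (intro computable_intros assms)

lemma computable_remdups [computable_intros]:
  assumes "computable l"
  shows "computable (\<lambda>a. remdups (l a))"
proof (rule computable_cong)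
  \<comment> \<open>Whether \<open>x\<close> is kept depends on the whole list behind it, which the
    fold therefore carries along.\<close>
  show "computable (\<lambda>a. snd (foldr (\<lambda>x s. (x # fst s, if x \<in> set (fst s) then snd s else x # snd s)) (l a) ([], [])))"
    by (intro computable_intros assms)
  have "foldr (\<lambda>x s. (x # fst s, if x \<in> set (fst s) then snd s else x # snd s)) xs ([], []) = (xs, remdups xs)"
    for xs :: "'b list"
    by (induction xs) auto
  then show "remdups (l a) = snd (foldr (\<lambda>x s. (x # fst s, if x \<in> set (fst s) then snd s else x # snd s)) (l a) ([], []))" for a
    by simp
qed

lemma computable_foldl_max [computable_intros]:
  assumes "computable l"
  shows "computable (\<lambda>a. foldl max 0 (l a) :: nat)"
  unfolding max_def by (intro computable_intros assms)

lemma computable_div [computable_intros]: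
  assumes "computable f" "computable g"
  shows "computable (\<lambda>a. f a div g a :: nat)"
proof (rule computable_cong)
  \<comment> \<open>The quotient is the number of positive \<open>k\<close> with
    \<open>k * g a \<le> f a\<close>, and such \<open>k\<close> are at most
    \<open>f a\<close>.\<close>
  show "computable (\<lambda>a. if g a = 0 then 0 else length (filter (\<lambda>k. k * g a \<le> f a) [1..<Suc (f a)]))"
    by (intro computable_intros assms computable_compose[OF assms(1)] computable_compose[OF assms(2)])
  show "f a div g a = (if g a = 0 then 0 else length (filter (\<lambda>k. k * g a \<le> f a) [1..<Suc (f a)]))" for a
  proof (cases "g a = 0")
    case False
    define d where "d = f a div g a"
    have iff: "k * g a \<le> f a \<longleftrightarrow> k \<le> d" for k
      using False less_eq_div_iff_mult_less_eq[of "g a" k "f a"] by (simp add: d_def)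
    have "d \<le> f a" by (simp add: d_def)
    then have "{k \<in> set [1..<Suc (f a)]. k * g a \<le> f a} = {1..<Suc d}"
      unfolding iff by (auto simp del: upt_Suc)
    then have "length (filter (\<lambda>k. k * g a \<le> f a) [1..<Suc (f a)]) = d"
      by (subst distinct_card[symmetric]) (simp_all del: upt_Suc)
    then show ?thesis using False by (simp add: d_def del: upt_Suc)
  qed simp
qed

lemma computable_finite_table:
  assumes "finite S"
  shows "computable (\<lambda>a. if a \<in> S then f a else c)"
  using assms
proof (induction S)
  case empty
  show ?case by (simp, rule computable_const)
next
  case (insert x S)
  have "computable (\<lambda>a. if a = x then f x else if a \<in> S then f a else c)"
    by (intro computable_intros insert.IH)
  then show ?case by (rule computable_cong) auto
qed


section \<open>Unbounded search\<close>

text \<open>The program need halt only where the search succeeds; this partial form is what a search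
  for certificates requires.\<close>

lemma eval_Least:
  fixes P :: "'a::enc \<Rightarrow> nat \<Rightarrow> bool"
  assumes P: "computable (\<lambda>t. P (fst t) (snd t))"
  obtains p where "\<And>a. (\<exists>n. P a n) \<Longrightarrow> eval p [enc a] (LEAST n. P a n)"
proof -
  obtain q where q: "\<And>a n. eval q [enc (a, n)] (if P a n then 0 else 1)"
  proof -
    have "computable (\<lambda>t. if P (fst t) (snd t) then 0 else (1::nat))" by (intro computable_intros P)
    then show ?thesis by (rule computableE) (metis enc_nat_def fst_conv snd_conv that)
  qed
  let ?q = "Comp q [Comp Pair_prog [Proj 1, Proj 0]]"
  have q': "eval ?q [n, enc a] (if P a n then 0 else 1)" for a n
    by (rule eval_Comp1[OF _ q])
      (auto simp: enc_prod_def enc_nat_def intro!: eval_Comp2 eval_Proj eval_Pair_prog)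
  have "eval (Mu ?q) [enc a] (LEAST n. P a n)" if "\<exists>n. P a n" for a
  proof (rule eval.Mu)
    show "eval ?q [LEAST n. P a n, enc a] 0" using q'[of "LEAST n. P a n" a] LeastI_ex[OF that] by simp
    fix m assume "m < (LEAST n. P a n)"
    then have "\<not> P a m" by (rule not_less_Least)
    then show "\<exists>y. eval ?q [m, enc a] (Suc y)" using q'[of m a] by auto
  qed
  then show ?thesis by (rule that)
qed

lemma computable_Least:
  fixes P :: "'a::enc \<Rightarrow> nat \<Rightarrow> bool"
  assumes P: "computable (\<lambda>t. P (fst t) (snd t))" and ex: "\<And>a. \<exists>n. P a n"
  shows "computable (\<lambda>a. LEAST n. P a n)"
  using eval_Least[OF P] ex unfolding computable_def enc_nat_def by metis

text \<open>The search runs through codes. Decoding costs nothing: by surjectivity of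
  \<open>enc\<close>, the identity program realizes \<open>?dec\<close>.\<close>

lemma computable_search:
  fixes P :: "'a::enc \<Rightarrow> 'b::enc_onto \<Rightarrow> bool"
  assumes P: "computable (\<lambda>t. P (fst t) (snd t))"
  obtains p where "\<And>a b. P a b \<Longrightarrow> \<exists>b. eval p [enc a] (enc b) \<and> P a b"
proof -
  let ?dec = "inv (enc :: 'b \<Rightarrow> nat)"
  have dec: "computable ?dec"
    by (rule computableI[of "Proj 0"])
      (auto simp: enc_nat_def surj_f_inv_f[OF surj_enc] intro: eval_Proj)
  have "computable (\<lambda>t. P (fst t) (?dec (snd t)))"
    by (rule computable_compose[OF P, of "\<lambda>t. (fst t, ?dec (snd t))", simplified])
      (intro computable_intros computable_compose[OF dec])
  then obtain p where p: "\<And>a. (\<exists>n. P a (?dec n)) \<Longrightarrow> eval p [enc a] (LEAST n. P a (?dec n))"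
    by (rule eval_Least) blast
  show ?thesis
  proof (rule that)
    fix a b assume "P a b"
    then have ex: "\<exists>n. P a (?dec n)" by (intro exI[of _ "enc b"]) (simp add: inv_f_f[OF inj_enc])
    show "\<exists>b. eval p [enc a] (enc b) \<and> P a b"
      by (intro exI[of _ "?dec (LEAST n. P a (?dec n))"])
        (simp add: surj_f_inv_f[OF surj_enc] p[OF ex] LeastI_ex[OF ex])
  qed
qed


section \<open>A universal relation\<close>

definition nth0 :: "nat list \<Rightarrow> nat \<Rightarrow> nat" where
  "nth0 xs n = (if n < length xs then xs ! n else 0)"

lemma computable_nth0 [computable_intros]:
  "computable l \<Longrightarrow> computable n \<Longrightarrow> computable (\<lambda>a. nth0 (l a) (n a))"
  unfolding nth0_def by (intro computable_intros)

text \<open>A triple \<open>(prog_code p, xs, y)\<close> stands for \<open>eval p xs y\<close>; it is justified by the triples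
  in \<open>E\<close> if it follows from them by a single evaluation rule.\<close>

definition justified :: "(nat \<times> nat list \<times> nat) list \<Rightarrow> nat \<times> nat list \<times> nat \<Rightarrow> bool" where
  "justified E e \<longleftrightarrow>
     (let c = fst (prod_decode (fst e)); r = snd (prod_decode (fst e));
          r1 = fst (prod_decode r); r2 = snd (prod_decode r);
          xs = fst (snd e); y = snd (snd e)
      in (c = 0 \<and> y = 0)
       \<or> (c = 1 \<and> xs = [y - Suc 0] \<and> 0 < y)
       \<or> (c = 2 \<and> r < length xs \<and> nth0 xs r = y)
       \<or> (c = 3 \<and> (\<exists>d\<in>set E. fst d = r1 \<and> snd (snd d) = y
            \<and> length (fst (snd d)) = length (list_decode r2)
            \<and> (\<forall>k<length (list_decode r2). (nth0 (list_decode r2) k, xs, nth0 (fst (snd d)) k) \<in> set E)))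
       \<or> (c = 4 \<and> (case xs of [] \<Rightarrow> False | n # zs \<Rightarrow>
            if n = 0 then (r1, zs, y) \<in> set E
            else \<exists>d\<in>set E. fst d = fst e \<and> fst (snd d) = (n - Suc 0) # zs
              \<and> (r2, (n - Suc 0) # snd (snd d) # zs, y) \<in> set E))
       \<or> (c = 5 \<and> (r, y # xs, 0) \<in> set E
            \<and> (\<forall>m<y. \<exists>d\<in>set E. fst d = r \<and> fst (snd d) = m # xs \<and> 0 < snd (snd d))))"

text \<open>An entry may be justified only by entries behind it, which rules out circular
  justification.\<close>

primrec valid :: "(nat \<times> nat list \<times> nat) list \<Rightarrow> bool" where
  "valid [] = True"
| "valid (e # E) = (justified E e \<and> valid E)"

text \<open>All quantifiers in \<open>justified\<close> range over \<open>E\<close> or below a given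
  number, so the relation is decidable.\<close>

lemma computable_justified [computable_intros]:
  assumes "computable f" "computable g"
  shows "computable (\<lambda>a. justified (f a) (g a))"
proof -
  have "computable (\<lambda>t. justified (fst t) (snd t))"
    unfolding justified_def Let_def by (intro computable_intros)
  from computable_compose[OF this computable_Pair[OF assms]] show ?thesis by simp
qed

lemma computable_valid [computable_intros]:
  assumes "computable f"
  shows "computable (\<lambda>a. valid (f a))"
proof (rule computable_cong)
  show "computable (\<lambda>a. snd (foldr (\<lambda>e s. (e # fst s, justified (fst s) e \<and> snd s)) (f a) ([], True)))"
    by (intro computable_intros assms)
  have "foldr (\<lambda>e s. (e # fst s, justified (fst s) e \<and> snd s)) E ([], True) = (E, valid E)" for E
    by (induction E) auto
  then show "valid (f a) = snd (foldr (\<lambda>e s. (e # fst s, justified (fst s) e \<and> snd s)) (f a) ([], True))" for a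
    by simp
qed

lemma justified_sound:
  assumes IH: "\<And>p xs y. (prog_code p, xs, y) \<in> set E \<Longrightarrow> eval p xs y"
    and just: "justified E (prog_code p, xs, y)"
  shows "eval p xs y"
proof (cases p)
  case Zero
  with just show ?thesis by (auto simp: justified_def intro: eval.Zero)
next
  case Succ
  with just show ?thesis by (auto simp: justified_def intro: eval_Succ)
next
  case (Proj i)
  with just show ?thesis by (auto simp: justified_def nth0_def intro: eval_Proj)
next
  case (Comp f gs)
  with just obtain ys where ys: "(prog_code f, ys, y) \<in> set E" "length ys = length gs"
    "\<And>k. k < length gs \<Longrightarrow> (nth0 (map prog_code gs) k, xs, nth0 ys k) \<in> set E"
    by (auto simp: justified_def)
  have "list_all2 (\<lambda>g y. eval g xs y) gs ys"
    using ys by (auto simp: list_all2_conv_all_nth nth0_def intro: IH)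
  then show ?thesis unfolding Comp using IH[OF ys(1)] by (rule eval.Comp)
next
  case (PrimRec f g)
  show ?thesis
  proof (cases xs)
    case Nil
    with PrimRec just show ?thesis by (simp add: justified_def)
  next
    case (Cons n zs)
    show ?thesis
    proof (cases n)
      case 0
      with PrimRec Cons just have "(prog_code f, zs, y) \<in> set E" by (simp add: justified_def)
      then show ?thesis unfolding PrimRec Cons 0 by (intro eval.PrimRec_0 IH)
    next
      case (Suc m)
      with PrimRec Cons just obtain v where
        "(prog_code (PrimRec f g), m # zs, v) \<in> set E" "(prog_code g, m # v # zs, y) \<in> set E"
        by (auto simp: justified_def Let_def)
      then show ?thesis unfolding PrimRec Cons Suc by (intro eval.PrimRec_Suc IH)
    qed
  qed
next
  case (Mu f)
  with just have 1: "(prog_code f, y # xs, 0) \<in> set E"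
    and "\<forall>m<y. \<exists>d\<in>set E. fst d = prog_code f \<and> fst (snd d) = m # xs \<and> 0 < snd (snd d)"
    by (simp_all add: justified_def Let_def)
  then have 2: "\<And>m. m < y \<Longrightarrow> \<exists>v. (prog_code f, m # xs, v) \<in> set E \<and> 0 < v"
    by (metis prod.collapse)
  show ?thesis unfolding Mu
  proof (rule eval.Mu[OF IH[OF 1]])
    fix m assume "m < y"
    from 2[OF this] obtain v where "(prog_code f, m # xs, v) \<in> set E" "0 < v" by blast
    then show "\<exists>v. eval f (m # xs) (Suc v)" using IH by (metis Suc_pred)
  qed
qed

lemma valid_sound: "valid E \<Longrightarrow> (prog_code p, xs, y) \<in> set E \<Longrightarrow> eval p xs y"
proof (induction E arbitrary: p xs y)
  case (Cons e E)
  then show ?case using justified_sound[of E p xs y] by auto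
qed simp

text \<open>\<open>E\<close> occurs only positively in \<open>justified\<close>.\<close>

lemma justified_mono: "justified E e \<Longrightarrow> set E \<subseteq> set F \<Longrightarrow> justified F e"
  unfolding justified_def Let_def
  by (elim disjE; cases "fst (snd e)"; simp split: if_splits; blast)

lemma valid_append: "valid E \<Longrightarrow> valid F \<Longrightarrow> valid (E @ F)"
  by (induction E) (auto elim: justified_mono)

definition derivable :: "nat \<times> nat list \<times> nat \<Rightarrow> bool" where
  "derivable e \<longleftrightarrow> (\<exists>E. valid E \<and> e \<in> set E)"

text \<open>By monotonicity valid lists can be concatenated, so finitely many premises share one
  list.\<close>

lemma finite_derivable: "finite S \<Longrightarrow> (\<And>e. e \<in> S \<Longrightarrow> derivable e) \<Longrightarrow> \<exists>E. valid E \<and> S \<subseteq> set E"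
proof (induction S rule: finite_induct)
  case (insert e S)
  then obtain E F where "valid E" "S \<subseteq> set E" "valid F" "e \<in> set F"
    unfolding derivable_def by (metis insert_iff)
  then show ?case by (intro exI[of _ "E @ F"] conjI valid_append) auto
qed (auto intro: exI[of _ "[]"])

lemma derivableI:
  assumes "finite S" "\<And>e. e \<in> S \<Longrightarrow> derivable e" "\<And>E. S \<subseteq> set E \<Longrightarrow> justified E e"
  shows "derivable e"
proof -
  obtain E where "valid E" "S \<subseteq> set E" using finite_derivable[OF assms(1,2)] by blast
  then show ?thesis unfolding derivable_def using assms(3) by (intro exI[of _ "e # E"]) auto
qed

lemma derivable_complete: "eval p xs y \<Longrightarrow> derivable (prog_code p, xs, y)"
proof (induction rule: eval.induct)
  case (Zero xs)
  then show ?case by (rule derivableI[of "{}"]) (auto simp: justified_def)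
next
  case (Succ n)
  then show ?case by (rule derivableI[of "{}"]) (auto simp: justified_def)
next
  case (Proj i xs)
  show ?case by (rule derivableI[of "{}"]) (use Proj in \<open>auto simp: justified_def nth0_def\<close>)
next
  case (Comp xs gs ys f z)
  let ?S = "insert (prog_code f, ys, z) ((\<lambda>k. (prog_code (gs ! k), xs, ys ! k)) ` {..<length gs})"
  show ?case
  proof (rule derivableI[of ?S])
    show "derivable e" if "e \<in> ?S" for e
      using that Comp.IH by (auto simp: list_all2_conv_all_nth)
    fix E assume E: "?S \<subseteq> set E"
    have "length ys = length gs" using Comp.IH(1) by (simp add: list_all2_lengthD)
    moreover have "(nth0 (map prog_code gs) k, xs, nth0 ys k) \<in> set E" if "k < length gs" for k
      using E that \<open>length ys = length gs\<close> by (auto simp: nth0_def)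
    ultimately show "justified E (prog_code (Comp f gs), xs, z)"
      using E by (auto simp: justified_def intro!: bexI[of _ "(prog_code f, ys, z)"])
  qed simp
next
  case (PrimRec_0 f xs y g)
  show ?case
    by (rule derivableI[of "{(prog_code f, xs, y)}"]) (use PrimRec_0.IH in \<open>auto simp: justified_def\<close>)
next
  case (PrimRec_Suc f g n xs y z)
  let ?S = "{(prog_code (PrimRec f g), n # xs, y), (prog_code g, n # y # xs, z)}"
  show ?case
  proof (rule derivableI[of ?S])
    show "derivable e" if "e \<in> ?S" for e using that PrimRec_Suc.IH by auto
    show "justified E (prog_code (PrimRec f g), Suc n # xs, z)" if "?S \<subseteq> set E" for E
      using that by (auto simp: justified_def Let_def
        intro!: bexI[of _ "(prod_encode (4, prod_encode (prog_code f, prog_code g)), n # xs, y)"])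
  qed simp
next
  case (Mu f n xs)
  have "\<forall>m. \<exists>y. m < n \<longrightarrow> derivable (prog_code f, m # xs, Suc y)" using Mu.IH(2) by blast
  then obtain Y where Y: "\<And>m. m < n \<Longrightarrow> derivable (prog_code f, m # xs, Suc (Y m))" by metis
  let ?S = "insert (prog_code f, n # xs, 0) ((\<lambda>m. (prog_code f, m # xs, Suc (Y m))) ` {..<n})"
  show ?case
  proof (rule derivableI[of ?S])
    show "derivable e" if "e \<in> ?S" for e using that Mu.IH(1) Y by auto
    fix E assume E: "?S \<subseteq> set E"
    have "\<exists>d\<in>set E. fst d = prog_code f \<and> fst (snd d) = m # xs \<and> 0 < snd (snd d)" if "m < n" for m
      using E that by (intro bexI[of _ "(prog_code f, m # xs, Suc (Y m))"]) auto
    then show "justified E (prog_code (Mu f), xs, n)" using E by (simp add: justified_def)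
  qed simp
qed

lemma finite_evals_valid:
  assumes "finite S" "\<And>p xs y. (p, xs, y) \<in> S \<Longrightarrow> eval p xs y"
  obtains E where "valid E" "\<And>p xs y. (p, xs, y) \<in> S \<Longrightarrow> (prog_code p, xs, y) \<in> set E"
proof -
  have "\<exists>E. valid E \<and> (\<lambda>(p, xs, y). (prog_code p, xs, y)) ` S \<subseteq> set E"
    using assms by (intro finite_derivable) (auto intro: derivable_complete)
  then show ?thesis using that by force
qed


section \<open>Bounded gaps and return words\<close>

lemma occurs_at_iff: "occurs_at x u i \<longleftrightarrow> (\<forall>k<length u. x (i + k) = u ! k)"
  unfolding occurs_at_def list_eq_iff_nth_eq by simp

lemma occurs_at_subsequence:
  "occurs_at x (x [i \<rightarrow> i + n]) j \<longleftrightarrow> (\<forall>k<n. x (j + k) = x (i + k))"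
  by (simp add: occurs_at_iff)

lemma factor_iff: "factor x u \<longleftrightarrow> (\<exists>i. u = x [i \<rightarrow> i + length u])"
  by (metis factor_def occurs_at_def)

lemma factor_subsequence: "factor x (x [i \<rightarrow> i + n])"
  unfolding factor_def by (rule exI[of _ i]) (simp add: occurs_at_subsequence)

text \<open>Positional form of return words: the return word is
  \<open>x [i \<rightarrow> i + d]\<close>. For given \<open>i\<close> and \<open>d\<close> it is
  decided by finitely many letters.\<close>

definition consecutive :: "'a word \<Rightarrow> 'a list \<Rightarrow> nat \<Rightarrow> nat \<Rightarrow> bool" where
  "consecutive x u i d \<longleftrightarrow> 0 < d \<and> occurs_at x u i \<and> occurs_at x u (i + d) \<and>
     (\<forall>k<d. 0 < k \<longrightarrow> \<not> occurs_at x u (i + k))"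

lemma occurrences_subsequence:
  "occurrences u (x [i \<rightarrow> i + n]) = {k. k + length u \<le> n \<and> occurs_at x u (i + k)}"
proof (intro set_eqI)
  fix k
  have "take (length u) (drop k (x [i \<rightarrow> i + n])) = x [i + k \<rightarrow> i + k + length u]"
    if "k + length u \<le> n" using that by (simp add: min_def add.commute add.left_commute)
  then show "k \<in> occurrences u (x [i \<rightarrow> i + n]) \<longleftrightarrow> k \<in> {k. k + length u \<le> n \<and> occurs_at x u (i + k)}"
    by (auto simp: occurrences_def occurs_at_def)
qed

lemma return_word_iff:
  "return_word x u r \<longleftrightarrow> (\<exists>i. r = x [i \<rightarrow> i + length r] \<and> consecutive x u i (length r))"
proof -
  let ?S = "occurrences u (r @ u)"
  have S: "?S \<subseteq> {..length r}" by (auto simp: occurrences_def)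
  then have fin: "finite ?S" by (rule finite_subset) simp
  have card: "card ?S = 2 \<and> 0 \<in> ?S \<and> length r \<in> ?S \<longleftrightarrow> 0 < length r \<and> ?S = {0, length r}"
  proof
    assume *: "card ?S = 2 \<and> 0 \<in> ?S \<and> length r \<in> ?S"
    have "length r \<noteq> 0"
    proof
      assume "length r = 0"
      then have "card ?S \<le> card {0::nat}" using S by (intro card_mono) auto
      with * show False by simp
    qed
    moreover from this have "{0, length r} = ?S" using * fin by (intro card_seteq) auto
    ultimately show "0 < length r \<and> ?S = {0, length r}" by simp
  next
    assume *: "0 < length r \<and> ?S = {0, length r}"
    then show "card ?S = 2 \<and> 0 \<in> ?S \<and> length r \<in> ?S"
      by (metis card_2_iff insertI1 insertI2 less_not_refl singletonI)
  qed
  have "occurs_at x (r @ u) i \<and> 0 < length r \<and> ?S = {0, length r} \<longleftrightarrow>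
      r = x [i \<rightarrow> i + length r] \<and> consecutive x u i (length r)" for i
  proof (cases "occurs_at x (r @ u) i")
    case True
    then have eq: "r @ u = x [i \<rightarrow> i + (length r + length u)]" by (simp add: occurs_at_def)
    have r: "r = x [i \<rightarrow> i + length r]" 
      using arg_cong[OF eq, of "take (length r)"] by (simp add: min_def)
    have occ: "?S = {k. k \<le> length r \<and> occurs_at x u (i + k)}"
      unfolding eq occurrences_subsequence by auto
    have "?S = {0, length r} \<longleftrightarrow> occurs_at x u i \<and> occurs_at x u (i + length r) \<and>
        (\<forall>k<length r. 0 < k \<longrightarrow> \<not> occurs_at x u (i + k))"
    proof
      assume *: "?S = {0, length r}"
      have "occurs_at x u (i + 0)" "occurs_at x u (i + length r)" using * unfolding occ by blast+
      moreover have "\<not> occurs_at x u (i + k)" if "k < length r" "0 < k" for k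
        using * that unfolding occ by (metis (mono_tags) insertE less_imp_le less_not_refl mem_Collect_eq singletonD)
      ultimately show "occurs_at x u i \<and> occurs_at x u (i + length r) \<and>
        (\<forall>k<length r. 0 < k \<longrightarrow> \<not> occurs_at x u (i + k))" by simp
    next
      assume *: "occurs_at x u i \<and> occurs_at x u (i + length r) \<and>
        (\<forall>k<length r. 0 < k \<longrightarrow> \<not> occurs_at x u (i + k))"
      then have "k = 0 \<or> k = length r" if "k \<le> length r" "occurs_at x u (i + k)" for k
        using that by (metis le_neq_implies_less not_gr_zero)
      then show "?S = {0, length r}" using * unfolding occ by auto
    qed
    then show ?thesis using True r unfolding consecutive_def by blast
  next
    case False
    have "occurs_at x (r @ u) i" if r: "r = x [i \<rightarrow> i + length r]" and c: "consecutive x u i (length r)"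
    proof -
      have "x (i + k) = r ! k" if "k < length r" for k
      proof -
        have "r ! k = x [i \<rightarrow> i + length r] ! k" using r by (rule arg_cong)
        then show ?thesis using that by simp
      qed
      moreover have "x (i + length r + k) = u ! k" if "k < length u" for k
        using c that by (simp add: consecutive_def occurs_at_iff)
      moreover have "x (i + k) = u ! (k - length r)" if "\<not> k < length r" "k < length (r @ u)" for k
        using calculation(2)[of "k - length r"] that by simp
      ultimately show ?thesis unfolding occurs_at_iff nth_append by simp
    qed
    then show ?thesis using False by blast
  qed
  then show ?thesis unfolding return_word_def factor_def card by blast
qed

definition return_lengths :: "'a word \<Rightarrow> nat \<Rightarrow> nat set" where
  "return_lengths x n = {d. \<exists>i. consecutive x (x [i \<rightarrow> i + n]) i d}"

lemma max_return_eq: "max_return x n = Max (return_lengths x n)"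
proof -
  have "{length r |u r. factor x u \<and> length u = n \<and> return_word x u r} = return_lengths x n"
    (is "?L = ?R")
  proof (intro subset_antisym subsetI)
    fix d assume "d \<in> ?L"
    then obtain u r where "d = length r" "length u = n" "return_word x u r" by blast
    then obtain i where i: "consecutive x u i d" "length u = n" by (auto simp: return_word_iff)
    then have "x [i \<rightarrow> i + n] = u" by (simp add: consecutive_def occurs_at_def)
    with i have "consecutive x (x [i \<rightarrow> i + n]) i d" by simp
    then show "d \<in> ?R" unfolding return_lengths_def by blast
  next
    fix d assume "d \<in> ?R"
    then obtain i where i: "consecutive x (x [i \<rightarrow> i + n]) i d" by (auto simp: return_lengths_def)
    let ?u = "x [i \<rightarrow> i + n]" and ?r = "x [i \<rightarrow> i + d]"
    have "factor x ?u" "length ?u = n" by (simp_all add: factor_subsequence)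
    moreover have "return_word x ?u ?r" using i by (auto simp: return_word_iff)
    ultimately show "d \<in> ?L" by force
  qed
  then show ?thesis by (simp add: max_return_def)
qed

text \<open>Unlike a bound on return words, this also bounds the wait from position 0 to the first
  occurrence.\<close>

definition gap_bound :: "'a word \<Rightarrow> 'a list \<Rightarrow> nat \<Rightarrow> bool" where
  "gap_bound x u L \<longleftrightarrow> (\<forall>i. \<exists>j. i \<le> j \<and> j < i + L \<and> occurs_at x u j)"

lemma next_occurrence:
  assumes "occurs_at x u i" "infinite {j. occurs_at x u j}"
  obtains d where "consecutive x u i d"
proof -
  obtain j where "i < j" "occurs_at x u j" using assms(2) by (auto simp: infinite_nat_iff_unbounded)
  then have ex: "\<exists>d. 0 < d \<and> occurs_at x u (i + d)" by (intro exI[of _ "j - i"]) simp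
  let ?d = "LEAST d. 0 < d \<and> occurs_at x u (i + d)"
  have "consecutive x u i ?d"
    unfolding consecutive_def using assms(1) LeastI_ex[OF ex] not_less_Least by blast
  then show ?thesis by (rule that)
qed

text \<open>The first occurrence of \<open>u\<close> poses no problem: a long prefix of \<open>x\<close> recurs.\<close>

lemma gap_bound_return:
  assumes rec: "recurrent x" and u: "factor x u"
    and L: "\<And>i d. consecutive x u i d \<Longrightarrow> d \<le> L"
  shows "gap_bound x u L"
  unfolding gap_bound_def
proof (intro allI)
  fix i
  have inf: "infinite {j. occurs_at x u j}" using rec u by (simp add: recurrent_def)
  have after: "\<exists>j. i \<le> j \<and> j < i + L \<and> occurs_at x u j" if "occurs_at x u k" "k \<le> i" for i k
  proof -
    let ?P = "\<lambda>k. occurs_at x u k \<and> k \<le> i"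
    let ?k = "GREATEST k. ?P k"
    have k: "?P ?k" using that by (intro GreatestI_nat[of ?P k i]) auto
    have max: "m \<le> ?k" if "?P m" for m using that by (intro Greatest_le_nat[of ?P m i]) auto
    obtain d where d: "consecutive x u ?k d" using next_occurrence k inf by blast
    then have occ: "occurs_at x u (?k + d)" "0 < d" "d \<le> L" using L by (auto simp: consecutive_def)
    show ?thesis
    proof (cases "?k = i")
      case True
      then show ?thesis using k occ by (intro exI[of _ i]) auto
    next
      case False
      have "\<not> ?k + d \<le> i" using max[of "?k + d"] occ by auto
      then show ?thesis using occ k False by (intro exI[of _ "?k + d"]) auto
    qed
  qed
  show "\<exists>j. i \<le> j \<and> j < i + L \<and> occurs_at x u j"
  proof -
    obtain m where m: "occurs_at x u m" using u by (auto simp: factor_def)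
    \<comment> \<open>The prefix covers all candidates for the occurrence. At a copy of it beyond
      \<open>m\<close> the case \<open>after\<close> applies, and the occurrence found there is
      moved back into the prefix.\<close>
    let ?w = "x [0 \<rightarrow> 0 + (i + L + length u)]"
    have "infinite {j. occurs_at x ?w j}" 
      using rec unfolding recurrent_def by (metis factor_def occurs_at_subsequence)
    then obtain n where n: "m < n" "occurs_at x ?w n" by (auto simp: infinite_nat_iff_unbounded)
    obtain j where j: "n + i \<le> j" "j < n + i + L" "occurs_at x u j"
      using after[of m "n + i"] m n by auto
    have "occurs_at x u (j - n)"
      unfolding occurs_at_iff
    proof (intro allI impI)
      fix k assume k: "k < length u"
      have "x (n + (j - n + k)) = x (0 + (j - n + k))"
        using n(2)[unfolded occurs_at_subsequence, rule_format, of "j - n + k"] j k by simp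
      then show "x (j - n + k) = u ! k" using j k by (simp add: occurs_at_iff)
    qed
    then show ?thesis using j by (intro exI[of _ "j - n"]) auto
  qed
qed

lemma finite_lists_range:
  assumes "finite (range x)"
  shows "finite {u. factor x u \<and> length u = n}"
proof (rule finite_subset)
  show "{u. factor x u \<and> length u = n} \<subseteq> {u. set u \<subseteq> range x \<and> length u = n}"
    unfolding factor_iff by clarify (metis image_subset_iff rangeI set_subsequence subset_iff)
  show "finite {u. set u \<subseteq> range x \<and> length u = n}" using assms by (rule finite_lists_length_eq)
qed

lemma gap_bound_consecutive:
  assumes "gap_bound x u L" "consecutive x u i d"
  shows "d \<le> L"
proof -
  obtain j where j: "i + 1 \<le> j" "j < i + 1 + L" "occurs_at x u j"
    using assms(1) unfolding gap_bound_def by blast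
  have "\<not> occurs_at x u (i + (j - i))" if "j - i < d"
  proof -
    have "0 < j - i" using j(1) by simp
    then show ?thesis using assms(2) that unfolding consecutive_def by blast
  qed
  then have "d \<le> j - i" using j(1,3) by fastforce
  then show ?thesis using j(2) by simp
qed

lemma uniformly_recurrentI:
  assumes fin: "finite (range x)" and gap: "\<And>u. factor x u \<Longrightarrow> \<exists>L. gap_bound x u L"
  shows "uniformly_recurrent x"
  unfolding uniformly_recurrent_def recurrent_def
proof (intro conjI allI impI)
  fix u assume u: "factor x u"
  then obtain L where L: "gap_bound x u L" using gap by blast
  then show "infinite {i. occurs_at x u i}"
    unfolding infinite_nat_iff_unbounded_le gap_bound_def by blast
  have "length r \<le> L" if "return_word x u r" for r
    using that gap_bound_consecutive[OF L] by (auto simp: return_word_iff)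
  moreover have "set r \<subseteq> range x" if "return_word x u r" for r
    using that unfolding return_word_iff by (metis image_mono set_subsequence subset_UNIV)
  ultimately have "{r. return_word x u r} \<subseteq> {r. set r \<subseteq> range x \<and> length r \<le> L}" by blast
  then show "finite {r. return_word x u r}" using finite_lists_length_le[OF fin] by (rule finite_subset)
qed

text \<open>The maximum is over a finite set: there are finitely many factors of each length, each
  with finitely many return words.\<close>

lemma gap_bound_max_return:
  assumes ur: "uniformly_recurrent x" and fin: "finite (range x)" and u: "factor x u"
  shows "gap_bound x u (max_return x (length u))"
proof (rule gap_bound_return)
  show "recurrent x" using ur by (simp add: uniformly_recurrent_def)
  have "return_lengths x n \<subseteq> (\<Union>v\<in>{v. factor x v \<and> length v = n}. length ` {r. return_word x v r})" for n
  proof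
    fix d assume "d \<in> return_lengths x n"
    then obtain i where i: "consecutive x (x [i \<rightarrow> i + n]) i d" by (auto simp: return_lengths_def)
    have "return_word x (x [i \<rightarrow> i + n]) (x [i \<rightarrow> i + d])" using i by (auto simp: return_word_iff)
    moreover have "factor x (x [i \<rightarrow> i + n])" by (simp_all add: factor_subsequence)
    ultimately show "d \<in> (\<Union>v\<in>{v. factor x v \<and> length v = n}. length ` {r. return_word x v r})" by force
  qed
  moreover have "finite (\<Union>v\<in>{v. factor x v \<and> length v = n}. length ` {r. return_word x v r})" for n
    using ur finite_lists_range[OF fin] by (auto simp: uniformly_recurrent_def)
  ultimately have fin: "finite (return_lengths x n)" for n by (metis finite_subset)
  fix i d assume "consecutive x u i d"
  then have "d \<in> return_lengths x (length u)"
    by (auto simp: return_lengths_def consecutive_def occurs_at_def intro!: exI[of _ i])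
  then show "d \<le> max_return x (length u)" unfolding max_return_eq using fin by simp
qed (rule u)

text \<open>All return words of length-\<open>n\<close> factors, each followed by its factor, occur in the prefix
  of \<open>x\<close> of length \<open>W (W n + n) + W n + n\<close>.\<close>

lemma max_return_computation:
  assumes gap: "\<And>u. factor x u \<Longrightarrow> gap_bound x u (W (length u))"
  shows "max_return x n = foldl max 0 (concat (map (\<lambda>i. filter (\<lambda>d. consecutive x (x [i \<rightarrow> i + n]) i d) [0..<Suc (W n)]) [0..<W (W n + n)]))"
    (is "_ = foldl max 0 ?l")
proof -
  have "(\<lambda>x s. max s x) = (max :: nat \<Rightarrow> _)" by (intro ext max.commute)
  then have fm: "foldl max m l = Max (set (m # l))" for m :: nat and l
    by (simp only: foldl_conv_fold Max.set_eq_fold)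
  have "set ?l = return_lengths x n"
  proof (intro subset_antisym subsetI)
    fix d assume "d \<in> return_lengths x n"
    then obtain i where i: "consecutive x (x [i \<rightarrow> i + n]) i d" by (auto simp: return_lengths_def)
    let ?u = "x [i \<rightarrow> i + n]" and ?v = "x [i \<rightarrow> i + (W n + n)]"
    have "factor x ?u" "factor x ?v" by (simp_all add: factor_subsequence)
    then have g: "gap_bound x ?u (W n)" "gap_bound x ?v (W (W n + n))" using gap by fastforce+
    have d: "d \<le> W n" using gap_bound_consecutive[OF g(1) i] .
    \<comment> \<open>The window \<open>?v\<close> contains both occurrences of \<open>?u\<close>,
      as \<open>d \<le> W n\<close>; hence its early copy at \<open>j\<close> shows the same
      pair.\<close>
    obtain j where j: "j < W (W n + n)" "occurs_at x ?v j"
      using g(2) unfolding gap_bound_def by (metis add_0)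
    then have eq: "x (j + k) = x (i + k)" if "k < W n + n" for k
      using that by (simp only: occurs_at_subsequence)
    have "x [j \<rightarrow> j + n] = ?u" using eq by (auto simp: list_eq_iff_nth_eq)
    moreover have "occurs_at x ?u (j + k) = occurs_at x ?u (i + k)" if "k \<le> d" for k
      using eq[of "k + _"] d that by (auto simp: occurs_at_subsequence add.assoc)
    ultimately have "consecutive x (x [j \<rightarrow> j + n]) j d"
      using i unfolding consecutive_def by (metis add.right_neutral le_refl less_imp_le zero_le)
    then show "d \<in> set ?l" using j d by (auto simp: less_Suc_eq_le simp del: upt_Suc)
  qed (auto simp: return_lengths_def simp del: upt_Suc)
  moreover have "return_lengths x n \<noteq> {}"
  proof -
    have "factor x (x [0 \<rightarrow> 0 + n])" by (rule factor_subsequence)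
    from gap[OF this] have "gap_bound x (x [0 \<rightarrow> 0 + n]) (W n)" by simp
    then have "infinite {j. occurs_at x (x [0 \<rightarrow> 0 + n]) j}"
      unfolding infinite_nat_iff_unbounded_le gap_bound_def by blast
    moreover have "occurs_at x (x [0 \<rightarrow> 0 + n]) 0" by (simp only: occurs_at_subsequence) simp
    ultimately obtain d where "consecutive x (x [0 \<rightarrow> 0 + n]) 0 d" using next_occurrence by blast
    then show ?thesis unfolding return_lengths_def by blast
  qed
  ultimately have 1: "max_return x n = Max (set ?l)" and 2: "set ?l \<noteq> {}"
    by (simp_all only: max_return_eq not_False_eq_True)
  \<comment> \<open>The initial value 0 of the fold does not change the maximum, since the set is
    non-empty.\<close>
  have "Max (insert 0 S) = Max S" if "finite S" "S \<noteq> {}" for S :: "nat set"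
    using that by (simp add: Max_insert)
  from this[OF List.finite_set 2] show ?thesis unfolding 1 fm list.set(2) ..
qed


section \<open>Synchronizing factors of counter-free transducers\<close>

lemma trans_word_append: "trans_word A (u @ v) q = trans_word A v (trans_word A u q)"
  by (simp add: trans_word_def)

lemma subsequence_split: "x [j \<rightarrow> j + (m + n)] = x [j \<rightarrow> j + m] @ x [j + m \<rightarrow> j + m + n]"
  unfolding subsequence_def add.assoc[symmetric]
  by (simp only: upt_add_eq_append[of j "j + m" n] le_add1 map_append)

lemma run_add: "run A x (j + n) = trans_word A (x [j \<rightarrow> j + n]) (run A x j)"
  by (induction n) (simp_all add: trans_word_def)

lemma trans_word_in_states:
  assumes "wf_transducer A" "set u \<subseteq> in_alph A" "q \<in> states A"
  shows "trans_word A u q \<in> states A"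
  using assms by (induction u arbitrary: q) (auto simp: trans_word_def wf_transducer_def)

lemma set_subsequence_subset: "range x \<subseteq> S \<Longrightarrow> set (x [i \<rightarrow> j]) \<subseteq> S"
  by auto

lemma run_in_states:
  assumes "wf_transducer A" "range x \<subseteq> in_alph A"
  shows "run A x n \<in> states A"
  using assms by (induction n) (auto simp: wf_transducer_def)

text \<open>The factor is given by position and length because the end \<open>i + l\<close> of this
  occurrence marks where the suffix of the output begins.\<close>

definition synced :: "('q, 'a, 'b) transducer \<Rightarrow> 'a word \<Rightarrow> nat \<Rightarrow> nat \<Rightarrow> bool" where
  "synced A x i l \<longleftrightarrow> (\<forall>j. occurs_at x (x [i \<rightarrow> i + l]) j \<longrightarrow> run A x (j + l) = run A x (i + l))"

text \<open>A factor whose state transformation has minimal rank synchronizes: between two of its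
  occurrences the transducer permutes the image of the transformation, and hence fixes it
  pointwise.\<close>

lemma synced_exists:
  assumes wf: "wf_transducer A" and cf: "counter_free A" and x: "range x \<subseteq> in_alph A"
  shows "\<exists>i l. synced A x i l"
proof -
  define im where "im u = trans_word A u ` states A" for u
  have fin: "finite (states A)" using wf by (simp add: wf_transducer_def)
  then have fin_im: "finite (im u)" for u by (simp add: im_def)
  have im_append: "im (u @ v) = trans_word A v ` im u" for u v
    by (simp add: im_def image_image trans_word_append)
  have im_sub: "im u \<subseteq> states A" if "set u \<subseteq> in_alph A" for u
    using trans_word_in_states[OF wf that] by (auto simp: im_def)
  have alph: "set (x [j \<rightarrow> k]) \<subseteq> in_alph A" for j k using x by (rule set_subsequence_subset)
  define f where "f p = card (im (x [fst p \<rightarrow> fst p + snd p]))" for p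
  obtain p where p: "\<And>p'. f p \<le> f p'" using ex_has_least_nat[of "\<lambda>_. True" undefined f] by auto
  define i l where "i = fst p" and "l = snd p"
  let ?u = "x [i \<rightarrow> i + l]"
  have min: "card (im ?u) \<le> card (im (x [j \<rightarrow> j + n]))" for j n
    using p[of "(j, n)"] by (simp add: f_def i_def l_def)
  have step: "run A x (j + d + l) = run A x (j + l)"
    if j: "occurs_at x ?u j" "occurs_at x ?u (j + d)" for j d
  proof (cases "d = 0")
    case False
    let ?r = "x [j + l \<rightarrow> j + l + d]" and ?S = "im ?u"
    have uj: "x [j \<rightarrow> j + l] = ?u" "x [j + d \<rightarrow> j + d + l] = ?u"
      using j by (simp_all add: occurs_at_def)
    \<comment> \<open>Valid for overlapping occurrences as well. The right-hand side ends in
      \<open>?u\<close>, so its image lies in \<open>?S\<close>; minimal rank then excludes a proper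
      subset.\<close>
    have eq: "?u @ ?r = x [j \<rightarrow> j + d] @ ?u"
      using subsequence_split[of x j l d] subsequence_split[of x j d l] uj by (simp add: add.commute)
    have "trans_word A ?r ` ?S = im (x [j \<rightarrow> j + d] @ ?u)" by (simp only: im_append[symmetric] eq)
    also have "\<dots> \<subseteq> ?S"
      using im_sub[OF alph] by (simp only: im_append) (simp add: im_def image_mono)
    finally have sub: "trans_word A ?r ` ?S \<subseteq> ?S" .
    have "trans_word A ?r ` ?S = im (x [j \<rightarrow> j + (l + d)])"
      using uj subsequence_split[of x j l d] by (simp only: im_append[symmetric])
    then have "card ?S \<le> card (trans_word A ?r ` ?S)" using min by simp
    then have surj: "trans_word A ?r ` ?S = ?S" using sub fin_im by (intro card_seteq) auto
    then have "bij_betw (trans_word A ?r) ?S ?S"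
      using finite_surj_inj[OF fin_im, of ?u "trans_word A ?r"] by (simp add: bij_betw_def)
    moreover have "?r \<noteq> []" using False by simp
    moreover note im_sub[OF alph, of i "i + l"] alph[of "j + l" "j + l + d"]
    ultimately have "\<not> (\<exists>q\<in>?S. trans_word A ?r q \<noteq> q)"
      using cf[unfolded counter_free_def not_ex, THEN spec, THEN spec, of ?r ?S] by satx
    then have pointwise: "trans_word A ?r q = q" if "q \<in> ?S" for q using that by blast
    have "run A x (j + l) \<in> ?S"
      using run_in_states[OF wf x, of j] uj(1) by (simp add: run_add im_def)
    then have "run A x (j + l + d) = run A x (j + l)" by (simp add: run_add[of A x "j + l" d] pointwise)
    then show ?thesis by (simp add: ac_simps)
  qed simp
  have "synced A x i l"
    unfolding synced_def
  proof (intro allI impI)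
    fix j assume j: "occurs_at x ?u j"
    have i: "occurs_at x ?u i" by (simp add: occurs_at_subsequence)
    show "run A x (j + l) = run A x (i + l)"
    proof (cases "i \<le> j")
      case True
      then show ?thesis using step[of i "j - i"] i j by simp
    next
      case False
      then show ?thesis using step[of j "i - j"] i j by simp
    qed
  qed
  then show ?thesis by blast
qed

text \<open>Induction on the position of the occurrence. A late \<open>j\<close> has an earlier
  occurrence \<open>j0\<close> at distance at most \<open>r1\<close>. The window of length
  \<open>r1 + l\<close> at \<open>j0\<close> covers both and has a copy at some
  \<open>j1 < r2\<close>, where both states were checked; hence the word between the two ends fixes
  the common state. By induction the run is in this state at \<open>j0 + l\<close>, and so at
  \<open>j + l\<close>.\<close>

lemma synced_criterion:
  assumes r1: "gap_bound x (x [i \<rightarrow> i + l]) r1"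
    and r2: "\<And>j. gap_bound x (x [j \<rightarrow> j + (r1 + l)]) r2"
    and check: "\<forall>j<r2 + r1. x [j \<rightarrow> j + l] = x [i \<rightarrow> i + l] \<longrightarrow> run A x (j + l) = run A x (i + l)"
  shows "synced A x i l"
  unfolding synced_def
proof (intro allI impI)
  let ?u = "x [i \<rightarrow> i + l]"
  fix j assume "occurs_at x ?u j"
  then show "run A x (j + l) = run A x (i + l)"
  proof (induction j rule: less_induct)
    case (less j)
    show ?case
    proof (cases "j < r2 + r1")
      case True
      then show ?thesis using check less.prems by (simp add: occurs_at_def)
    next
      case False
      obtain j0 where j0: "j - r1 \<le> j0" "j0 < j" "occurs_at x ?u j0"
        using r1[unfolded gap_bound_def, rule_format, of "j - r1"] False by auto
      define d where "d = j - j0"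
      have d: "j = j0 + d" "d \<le> r1" using j0 by (auto simp: d_def)
      obtain j1 where j1: "j1 < r2" "occurs_at x (x [j0 \<rightarrow> j0 + (r1 + l)]) j1"
        using r2[of j0] unfolding gap_bound_def by (metis add_0)
      have eq: "x (j1 + k) = x (j0 + k)" if "k < r1 + l" for k
        using j1(2) that by (simp only: occurs_at_subsequence)
      have "occurs_at x ?u j1" "occurs_at x ?u (j1 + d)"
        using j0(3) less.prems eq d by (auto simp: occurs_at_subsequence add.assoc)
      then have "run A x (j1 + l) = run A x (i + l)" "run A x (j1 + d + l) = run A x (i + l)"
        using check j1(1) d(2) by (simp_all add: occurs_at_def)
      then have "run A x (j1 + l) = run A x (i + l)" "run A x (j1 + l + d) = run A x (i + l)"
        by (simp_all add: ac_simps)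
      moreover have "run A x (j0 + l) = run A x (i + l)" using less.IH j0 by blast
      moreover have "x [j1 + l \<rightarrow> j1 + l + d] = x [j0 + l \<rightarrow> j0 + l + d]"
        using eq d(2) by (auto simp: list_eq_iff_nth_eq add.assoc)
      ultimately have "run A x (j0 + l + d) = run A x (i + l)"
        by (metis run_add)
      then show ?thesis by (simp add: d(1) ac_simps)
    qed
  qed
qed


section \<open>The output word\<close>

primrec outs :: "('q, 'a, 'b) transducer \<Rightarrow> 'q \<Rightarrow> 'a list \<Rightarrow> 'b list" where
  "outs A q [] = []"
| "outs A q (a # w) = out_fun A q a @ outs A (trans_fun A q a) w"

lemma outs_append: "outs A q (u @ v) = outs A q u @ outs A (trans_word A u q) v"
  by (induction u arbitrary: q) (auto simp: trans_word_def)

lemma out_prefix_eq: "out_prefix A x n = outs A (initial A) (x [0 \<rightarrow> n])"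
proof (induction n)
  case (Suc n)
  have "run A x n = trans_word A (x [0 \<rightarrow> n]) (initial A)" using run_add[of A x 0 n] by simp
  with Suc show ?case by (simp add: outs_append) (simp add: out_prefix_def)
qed (simp add: out_prefix_def)

lemma out_prefix_add:
  "out_prefix A x (j + n) = out_prefix A x j @ outs A (run A x j) (x [j \<rightarrow> j + n])"
  using run_add[of A x 0 j] subsequence_split[of x 0 j n] by (simp add: out_prefix_eq outs_append)

abbreviation out_length :: "('q, 'a, 'b) transducer \<Rightarrow> 'a word \<Rightarrow> nat \<Rightarrow> nat" where
  "out_length A x n \<equiv> length (out_prefix A x n)"

lemma out_length_mono: "j \<le> k \<Longrightarrow> out_length A x j \<le> out_length A x k"
  using out_prefix_add[of A x j "k - j"] by simp

lemma out_prefix_nth: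
  assumes "p < out_length A x n"
  shows "out_prefix A x n ! p = output_word A x p"
proof -
  let ?m = "LEAST n. p < out_length A x n"
  have "?m \<le> n" using assms by (rule Least_le)
  moreover have "p < out_length A x ?m" using assms by (rule LeastI)
  ultimately show ?thesis
    using out_prefix_add[of A x ?m "n - ?m"] by (simp add: output_word_def nth_append)
qed

lemma outs_eq_subsequence:
  "outs A (run A x j) (x [j \<rightarrow> j + n]) = output_word A x [out_length A x j \<rightarrow> out_length A x (j + n)]"
proof (rule nth_equalityI)
  show "length (outs A (run A x j) (x [j \<rightarrow> j + n])) =
      length (output_word A x [out_length A x j \<rightarrow> out_length A x (j + n)])"
    by (simp add: out_prefix_add)
  fix p assume p: "p < length (outs A (run A x j) (x [j \<rightarrow> j + n]))"
  then have "outs A (run A x j) (x [j \<rightarrow> j + n]) ! p = out_prefix A x (j + n) ! (out_length A x j + p)"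
    by (simp add: out_prefix_add)
  also have "\<dots> = output_word A x (out_length A x j + p)"
    using p by (intro out_prefix_nth) (simp add: out_prefix_add)
  finally show "outs A (run A x j) (x [j \<rightarrow> j + n]) ! p =
      output_word A x [out_length A x j \<rightarrow> out_length A x (j + n)] ! p"
    using p by (simp add: out_prefix_add)
qed

lemma occurs_at_output_word:
  assumes "e + length v \<le> length (outs A (run A x j) (x [j \<rightarrow> j + n]))"
  shows "occurs_at (output_word A x) v (out_length A x j + e) \<longleftrightarrow>
     take (length v) (drop e (outs A (run A x j) (x [j \<rightarrow> j + n]))) = v"
proof -
  have "out_length A x j + e + length v \<le> out_length A x (j + n)"
    using assms by (simp add: out_prefix_add)
  then show ?thesis
    by (simp add: occurs_at_def outs_eq_subsequence min_def add.commute add.left_commute)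
qed

section \<open>Runs with a synchronizing factor: uniform recurrence of the output\<close>

locale synced_run =
  fixes A :: "('q, 'a, 'b) transducer" and x :: "'a word" and i l :: nat
  assumes wf: "wf_transducer A" and x_alph: "range x \<subseteq> in_alph A"
    and ur: "uniformly_recurrent x" and inf: "output_infinite A x"
    and synced: "synced A x i l"
begin

abbreviation "u \<equiv> x [i \<rightarrow> i + l]"
abbreviation "P \<equiv> out_length A x"
abbreviation "Y \<equiv> output_word A x"
abbreviation "y \<equiv> suffix (P (i + l)) Y"

lemma fin: "finite (range x)"
  using x_alph by (rule finite_subset) (use wf in \<open>simp add: wf_transducer_def\<close>)

lemma gap: "factor x w \<Longrightarrow> gap_bound x w (max_return x (length w))"
  using gap_bound_max_return[OF ur fin] .

lemma gap_subsequence: "gap_bound x (x [j \<rightarrow> j + n]) (max_return x n)"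
  using gap[OF factor_subsequence] by simp

lemma run_synced: "occurs_at x u j \<Longrightarrow> run A x (j + l) = run A x (i + l)"
  using synced by (auto simp: synced_def)

text \<open>The leading \<open>u\<close> fixes the state at offset \<open>l\<close>, and from there
  on both copies read the same letters.\<close>

lemma window_run:
  assumes "occurs_at x u j" "occurs_at x (x [j \<rightarrow> j + n]) j'" "l \<le> d" "d \<le> n"
  shows "run A x (j' + d) = run A x (j + d)"
proof -
  have eq: "x (j' + k) = x (j + k)" if "k < n" for k
    using assms(2) that by (simp only: occurs_at_subsequence)
  have "occurs_at x u j'" using assms eq by (simp add: occurs_at_subsequence)
  then have "run A x (j' + l) = run A x (j + l)" using assms(1) run_synced by metis
  moreover have "x [j' + l \<rightarrow> j' + l + (d - l)] = x [j + l \<rightarrow> j + l + (d - l)]"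
    using eq assms by (auto simp: list_eq_iff_nth_eq add.assoc)
  ultimately have "run A x (j' + l + (d - l)) = run A x (j + l + (d - l))" by (metis run_add)
  then show ?thesis using assms by simp
qed

lemma window_outs:
  assumes "occurs_at x u j" "occurs_at x (x [j \<rightarrow> j + n]) j'" "l \<le> d" "d + m \<le> n"
  shows "outs A (run A x (j' + d)) (x [j' + d \<rightarrow> j' + d + m]) =
    outs A (run A x (j + d)) (x [j + d \<rightarrow> j + d + m])"
proof -
  have "x (j' + k) = x (j + k)" if "k < n" for k
    using assms(2) that by (simp only: occurs_at_subsequence)
  then have "x [j' + d \<rightarrow> j' + d + m] = x [j + d \<rightarrow> j + d + m]"
    using assms by (auto simp: list_eq_iff_nth_eq add.assoc)
  then show ?thesis using window_run[OF assms(1-3)] assms(4) by simp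
qed

lemma P_0: "P 0 = 0"
  by (simp add: out_prefix_def)

lemma P_unbounded: "\<exists>k. p < P k"
  using inf by (simp add: output_infinite_def)

text \<open>Blocks may be empty; the predecessor of the least \<open>k\<close> with
  \<open>p < P k\<close> is a block that contains \<open>p\<close>.\<close>

lemma block:
  obtains k where "P k \<le> p" "p < P (Suc k)"
proof -
  let ?n = "LEAST k. p < P k"
  have n: "p < P ?n" using P_unbounded by (rule LeastI_ex)
  then obtain k where k: "?n = Suc k" using P_0 by (cases ?n) auto
  then have "\<not> p < P k" using not_less_Least[of k "\<lambda>k. p < P k"] by simp
  then show ?thesis using n k that[of k] by simp
qed

text \<open>Some letter at or beyond \<open>i + l\<close> has non-empty output. The window from
  \<open>i\<close> through this letter starts with \<open>u\<close>, so every copy of it repeats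
  that output, and its gap bound plus its length serves as \<open>K\<close>.\<close>

lemma exists_growth: "\<exists>K>0. \<forall>t. P t < P (t + K)"
proof -
  obtain k where k: "P k \<le> P (i + l)" "P (i + l) < P (Suc k)" by (rule block)
  then have "\<not> Suc k \<le> i + l" using out_length_mono[of "Suc k" "i + l" A x] by linarith
  then have ik: "i + l \<le> k" by simp
  define d where "d = k - i"
  have d: "l \<le> d" "k = i + d" using ik by (auto simp: d_def)
  let ?K = "max_return x (d + 1) + d + 1"
  have "P t < P (t + ?K)" for t
  proof -
    obtain j where j: "t \<le> j" "j < t + max_return x (d + 1)" "occurs_at x (x [i \<rightarrow> i + (d + 1)]) j"
      using gap_subsequence[of i "d + 1"] unfolding gap_bound_def by blast
    have "occurs_at x u i" by (simp add: occurs_at_subsequence)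
    from window_outs[OF this j(3) d(1), of 1]
    have "length (outs A (run A x (j + d)) (x [j + d \<rightarrow> j + d + 1])) = P (Suc k) - P k"
      using out_prefix_add[of A x k 1] d(2) by simp
    then have "P (j + d) < P (j + d + 1)"
      using out_prefix_add[of A x "j + d" 1] k by simp
    moreover have "P t \<le> P (j + d)" "P (j + d + 1) \<le> P (t + ?K)"
      using j by (auto intro!: out_length_mono)
    ultimately show ?thesis by linarith
  qed
  then show ?thesis by (intro exI[of _ ?K]) simp
qed

text \<open>The value is never computed: the programs for \<open>y\<close> contain it as a constant.
  The same goes for \<open>C\<close>.\<close>

definition K where "K = (SOME K. 0 < K \<and> (\<forall>t. P t < P (t + K)))"

lemma K_pos: "0 < K" and P_less_add_K: "P t < P (t + K)"
  using someI_ex[OF exists_growth] unfolding K_def by auto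

lemma P_growth: "P t + n \<le> P (t + K * n)"
proof (induction n)
  case (Suc n)
  have "P (t + K * n) < P (t + K * n + K)" by (rule P_less_add_K)
  with Suc show ?case by (simp add: ac_simps)
qed simp

lemma exists_out_bound: "\<exists>C>0. \<forall>k. P (Suc k) \<le> P k + C"
proof -
  let ?S = "(\<lambda>(q, a). length (out_fun A q a)) ` (states A \<times> in_alph A)"
  have "finite ?S" using wf by (simp add: wf_transducer_def)
  then have "length (out_fun A (run A x k) (x k)) \<le> Max ?S" for k
    using run_in_states[OF wf x_alph] x_alph by (intro Max_ge) (auto intro!: image_eqI[of _ _ "(run A x k, x k)"])
  then have "P (Suc k) \<le> P k + Suc (Max ?S)" for k
    using out_prefix_add[of A x k 1] by (simp add: le_SucI)
  then show ?thesis by blast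
qed

definition C where "C = (SOME C. 0 < C \<and> (\<forall>k. P (Suc k) \<le> P k + C))"

lemma C_pos: "0 < C" and P_Suc_le: "P (Suc k) \<le> P k + C"
  using someI_ex[OF exists_out_bound] unfolding C_def by auto

lemma P_add_le: "P (k + n) \<le> P k + C * n"
proof (induction n)
  case (Suc n)
  then show ?case using P_Suc_le[of "k + n"] by simp
qed simp

text \<open>\<open>l + max_return x l\<close> letters contain a full occurrence of \<open>u\<close>
  and so determine the state; one letter has the block in which a word of length \<open>n\<close>
  starts; \<open>K * n\<close> more letters output at least \<open>n\<close> symbols.\<close>

definition width where "width n = l + max_return x l + 1 + K * n"

text \<open>At most \<open>max_return x (width n) + width n + 1\<close> letters lie between the
  block of a given position and a block in which \<open>v\<close> starts; each outputs at most
  \<open>C\<close> symbols, and a further \<open>C\<close> pays for the offset of \<open>v\<close>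
  in its block.\<close>

definition y_gap where "y_gap n = C * (max_return x (width n) + width n + 2) + 1"

text \<open>\<open>v\<close> starts at offset \<open>e\<close> of the block of letter
  \<open>k\<close>. A window of length \<open>width (length v)\<close> from a shortly preceding
  \<open>u\<close> determines the output from that block on, so every copy of the window carries an
  occurrence of \<open>v\<close>, and a copy begins soon after the block of
  \<open>p1\<close>.\<close>

lemma gap_bound_y:
  assumes "factor y v"
  shows "gap_bound y v (y_gap (length v))"
  unfolding gap_bound_def
proof
  fix p1
  let ?M = "width (length v)" and ?m = "1 + K * length v"
  obtain p0 where "occurs_at y v p0" using assms by (auto simp: factor_def)
  then have p0: "occurs_at Y v (P (i + l) + p0)" by (simp add: occurs_at_iff add.assoc)
  obtain k where k: "P k \<le> P (i + l) + p0" "P (i + l) + p0 < P (Suc k)" by (rule block)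
  have ik: "i + l \<le> k"
  proof (rule ccontr)
    assume "\<not> i + l \<le> k"
    then have "P (Suc k) \<le> P (i + l)" by (intro out_length_mono) simp
    then show False using k by simp
  qed
  define e where "e = P (i + l) + p0 - P k"
  have e: "P (i + l) + p0 = P k + e" "e < C" using k P_Suc_le[of k] by (auto simp: e_def)
  \<comment> \<open>If \<open>k\<close> is too small to step back by the gap bound, the occurrence
    at \<open>i\<close> itself is close enough; it ends in time because
    \<open>i + l \<le> k\<close>.\<close>
  have "\<exists>j. occurs_at x u j \<and> j + l \<le> k \<and> k < j + l + max_return x l"
  proof (cases "max_return x l \<le> k - l + 1")
    case True
    then show ?thesis
      using gap_subsequence[of i l, unfolded gap_bound_def, rule_format, of "k - l + 1 - max_return x l"] ik
      by (fastforce simp: le_diff_conv)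
  next
    case False
    then show ?thesis using ik by (intro exI[of _ i]) (auto simp: occurs_at_subsequence)
  qed
  then obtain j where j: "occurs_at x u j" "j + l \<le> k" "k < j + l + max_return x l" by blast
  define d where "d = k - j"
  have d: "k = j + d" "l \<le> d" "d + ?m \<le> ?M" using j by (auto simp: d_def width_def)
  obtain k1 where k1: "P k1 \<le> P (i + l) + p1" "P (i + l) + p1 < P (Suc k1)" by (rule block)
  obtain j' where j': "Suc k1 \<le> j'" "j' < Suc k1 + max_return x ?M" "occurs_at x (x [j \<rightarrow> j + ?M]) j'"
    using gap_subsequence[of j ?M] unfolding gap_bound_def by blast
  note eq = window_outs[OF j(1) j'(3) d(2,3)]
  have len: "e + length v \<le> length (outs A (run A x k) (x [k \<rightarrow> k + ?m]))"
    using P_growth[of "Suc k" "length v"] k e out_prefix_add[of A x k ?m] by simp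
  have "take (length v) (drop e (outs A (run A x k) (x [k \<rightarrow> k + ?m]))) = v"
    using p0 unfolding e(1) occurs_at_output_word[OF len] .
  then have "occurs_at Y v (P (j' + d) + e)"
    using len unfolding d(1) eq[symmetric] by (subst occurs_at_output_word)
  moreover have low: "P (i + l) + p1 < P (j' + d) + e"
    using k1(2) out_length_mono[of "Suc k1" "j' + d" A x] j'(1) by simp
  ultimately have "occurs_at y v (P (j' + d) + e - P (i + l))"
    by (simp add: occurs_at_iff)
  moreover have "P (j' + d) + e < P (i + l) + p1 + y_gap (length v)"
  proof -
    have "P (j' + d) \<le> P (k1 + (max_return x ?M + ?M + 1))"
      using j' d by (intro out_length_mono) simp
    also have "\<dots> \<le> P k1 + C * (max_return x ?M + ?M + 1)" by (rule P_add_le)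
    finally show ?thesis using k1(1) e(2) by (simp add: y_gap_def)
  qed
  ultimately show "\<exists>j\<ge>p1. j < p1 + y_gap (length v) \<and> occurs_at y v j"
    using low by (intro exI[of _ "P (j' + d) + e - P (i + l)"]) auto
qed

lemma range_Y: "range Y \<subseteq> out_alph A"
proof
  have outs: "set (outs A q w) \<subseteq> out_alph A" if "q \<in> states A" "set w \<subseteq> in_alph A" for q w
    using that wf by (induction w arbitrary: q) (auto simp: wf_transducer_def)
  fix b assume "b \<in> range Y"
  then obtain p where p: "b = Y p" by blast
  obtain n where n: "p < P n" using P_unbounded by blast
  then have "b \<in> set (out_prefix A x n)" using out_prefix_nth[OF n] p nth_mem by metis
  then show "b \<in> out_alph A"
    using outs[of "initial A" "x [0 \<rightarrow> n]"] set_subsequence_subset[OF x_alph] wf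
    by (auto simp: out_prefix_eq wf_transducer_def)
qed

lemma finite_range_y: "finite (range y)"
proof (rule finite_subset)
  show "range y \<subseteq> out_alph A" using range_Y by auto
  show "finite (out_alph A)" using wf by (simp add: wf_transducer_def)
qed

lemma uniformly_recurrent_y: "uniformly_recurrent y"
  using gap_bound_y by (intro uniformly_recurrentI finite_range_y) blast

end


section \<open>Averages\<close>

lemma sum_lessThan_add: "(\<Sum>k<N + m. f k) = (\<Sum>k<m. f k) + (\<Sum>k<N. f (k + m))"
  for f :: "nat \<Rightarrow> real"
  by (induction N) auto

text \<open>Both directions are used: one to restore the first \<open>past\<close> blocks, whose
  state no window determines, the other to drop the output in front of \<open>y\<close>.\<close>

lemma average_shift_iff:
  fixes f :: "nat \<Rightarrow> real"
  shows "(\<lambda>N. (\<Sum>k<N. f (k + m)) / real N) \<longlonglongrightarrow> L \<longleftrightarrow> (\<lambda>N. (\<Sum>k<N. f k) / real N) \<longlonglongrightarrow> L"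
proof -
  let ?c = "\<Sum>k<m. f k" and ?S = "\<lambda>N. \<Sum>k<N. f (k + m)" and ?T = "\<lambda>N. \<Sum>k<N. f k"
  have c0: "(\<lambda>N. ?c / real (N + m)) \<longlonglongrightarrow> 0"
    using LIMSEQ_ignore_initial_segment[OF lim_const_over_n[of ?c], of m] by simp
  have m0: "(\<lambda>N. real m / real (N + m)) \<longlonglongrightarrow> 0"
    using LIMSEQ_ignore_initial_segment[OF lim_const_over_n[of "real m"], of m] by simp
  show ?thesis
  proof
    assume S: "(\<lambda>N. ?S N / real N) \<longlonglongrightarrow> L"
    have "(\<lambda>N. ?c / real (N + m) + ?S N / real N * (1 - real m / real (N + m))) \<longlonglongrightarrow> 0 + L * (1 - 0)"
      by (intro tendsto_intros c0 m0 S)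
    moreover have "\<forall>\<^sub>F N in sequentially. ?c / real (N + m) + ?S N / real N * (1 - real m / real (N + m)) =
        ?T (N + m) / real (N + m)"
      using eventually_gt_at_top[of 0]
    proof eventually_elim
      case (elim N)
      then have "1 - real m / real (N + m) = real N / real (N + m)" by (simp add: field_simps)
      then show ?case using elim by (simp add: sum_lessThan_add add_divide_distrib)
    qed
    ultimately have "(\<lambda>N. ?T (N + m) / real (N + m)) \<longlonglongrightarrow> L"
      by (simp add: tendsto_cong)
    then show "(\<lambda>N. ?T N / real N) \<longlonglongrightarrow> L" by (rule LIMSEQ_offset)
  next
    assume T: "(\<lambda>N. ?T N / real N) \<longlonglongrightarrow> L"
    have T': "(\<lambda>N. ?T (N + m) / real (N + m)) \<longlonglongrightarrow> L" using T by (rule LIMSEQ_ignore_initial_segment)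
    have "(\<lambda>N. ?T (N + m) / real (N + m) * (1 + real m / real N) - ?c / real N) \<longlonglongrightarrow> L * (1 + 0) - 0"
      by (intro tendsto_intros T' lim_const_over_n)
    moreover have "\<forall>\<^sub>F N in sequentially. ?T (N + m) / real (N + m) * (1 + real m / real N) - ?c / real N =
        ?S N / real N"
      using eventually_gt_at_top[of 0]
    proof eventually_elim
      case (elim N)
      have "1 + real m / real N = real (N + m) / real N" using elim by (simp add: field_simps)
      then have "?T (N + m) / real (N + m) * (1 + real m / real N) = ?T (N + m) / real N"
        using elim by (simp del: of_nat_add)
      then show ?case by (simp add: sum_lessThan_add add_divide_distrib)
    qed
    ultimately show "(\<lambda>N. ?S N / real N) \<longlonglongrightarrow> L" by (simp add: tendsto_cong)
  qed
qed

lemma emp_freq_eq_average: "emp_freq x u N = (\<Sum>k<N. of_bool (occurs_at x u k)) / real N"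
proof -
  have "{..<N} \<inter> {k. occurs_at x u k} = {k. k < N \<and> occurs_at x u k}" by auto
  then show ?thesis by (simp add: emp_freq_def)
qed

text \<open>The frequency of an event read off position by position from blocks of bounded length is
  the quotient of the averages of events per block and of block lengths.\<close>

lemma block_average_quotient:
  fixes c P :: "nat \<Rightarrow> nat"
  assumes mono_c: "\<And>N. c N \<le> c (Suc N)" and c_Suc: "\<And>N. c (Suc N) \<le> Suc (c N)"
    and P: "P 0 = 0" "mono P" "\<And>k. P (Suc k) \<le> P k + C" "\<And>p. \<exists>k. p < P k"
    and F: "(\<lambda>k. real (c (P k)) / real k) \<longlonglongrightarrow> F" and D: "(\<lambda>k. real (P k) / real k) \<longlonglongrightarrow> D"
    and D0: "D \<noteq> 0"
  shows "(\<lambda>N. real (c N) / real N) \<longlonglongrightarrow> F / D"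
proof -
  have "\<exists>k. P k \<le> N \<and> N < P (Suc k)" for N
  proof -
    let ?n = "LEAST k. N < P k"
    have n: "N < P ?n" using P(4) by (rule LeastI_ex)
    then obtain k where k: "?n = Suc k" using P(1) by (cases ?n) auto
    then have "\<not> N < P k" using not_less_Least[of k "\<lambda>k. N < P k"] by simp
    then show ?thesis using n k by (intro exI[of _ k]) simp
  qed
  then obtain \<kappa> where \<kappa>: "\<And>N. P (\<kappa> N) \<le> N" "\<And>N. N < P (Suc (\<kappa> N))" by metis
  have "\<forall>\<^sub>F N in sequentially. k \<le> \<kappa> N" for k
    using eventually_ge_at_top[of "P k"]
  proof eventually_elim
    case (elim N)
    show ?case
    proof (rule ccontr)
      assume "\<not> k \<le> \<kappa> N"
      then have "P (Suc (\<kappa> N)) \<le> P k" using P(2) by (simp add: monoD)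
      then show False using \<kappa>(2)[of N] elim by simp
    qed
  qed
  then have lim: "filterlim \<kappa> at_top sequentially" by (simp add: filterlim_at_top)
  have C0: "(\<lambda>N. real C / real (\<kappa> N)) \<longlonglongrightarrow> 0"
    using filterlim_compose[OF lim_const_over_n lim] .
  have diff: "N \<le> P (\<kappa> N) + C" for N
    using \<kappa>(2)[of N] P(3)[of "\<kappa> N"] by simp
  have c_add: "c M \<le> c (M + n) \<and> c (M + n) \<le> c M + n" for M n
  proof (induction n)
    case (Suc n)
    then show ?case using mono_c[of "M + n"] c_Suc[of "M + n"] by simp
  qed simp
  have c_diff: "c (P (\<kappa> N)) \<le> c N \<and> c N \<le> c (P (\<kappa> N)) + C" for N
    using c_add[of "P (\<kappa> N)" "N - P (\<kappa> N)"] \<kappa>(1)[of N] diff[of N] by auto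
  \<comment> \<open>Moving \<open>N\<close> back to the start of its block changes the position and
    the count by at most \<open>C\<close>, which vanishes on division by
    \<open>\<kappa> N\<close>.\<close>
  have approx: "(\<lambda>N. real (b N) / real (\<kappa> N)) \<longlonglongrightarrow> B"
    if "(\<lambda>N. real (a N) / real (\<kappa> N)) \<longlonglongrightarrow> B" "\<And>N. a N \<le> b N \<and> b N \<le> a N + C" for a b :: "nat \<Rightarrow> nat" and B
  proof (rule tendsto_sandwich)
    show "\<forall>\<^sub>F N in sequentially. real (a N) / real (\<kappa> N) \<le> real (b N) / real (\<kappa> N)"
      using that(2) by (intro always_eventually allI divide_right_mono) auto
    have "real (b N) \<le> real (a N) + real C" for N using that(2)[of N] by linarith
    then show "\<forall>\<^sub>F N in sequentially. real (b N) / real (\<kappa> N) \<le> real (a N) / real (\<kappa> N) + real C / real (\<kappa> N)"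
      unfolding add_divide_distrib[symmetric] by (intro always_eventually allI divide_right_mono) auto
    show "(\<lambda>N. real (a N) / real (\<kappa> N) + real C / real (\<kappa> N)) \<longlonglongrightarrow> B"
      using tendsto_add[OF that(1) C0] by simp
  qed (rule that(1))
  have "(\<lambda>N. real (c N) / real (\<kappa> N)) \<longlonglongrightarrow> F"
    using approx[OF filterlim_compose[OF F lim]] c_diff by blast
  moreover have "(\<lambda>N. real N / real (\<kappa> N)) \<longlonglongrightarrow> D"
    using approx[OF filterlim_compose[OF D lim], of "\<lambda>N. N"] \<kappa>(1) diff by blast
  ultimately have "(\<lambda>N. (real (c N) / real (\<kappa> N)) / (real N / real (\<kappa> N))) \<longlonglongrightarrow> F / D"
    using D0 by (intro tendsto_divide)
  moreover have "\<forall>\<^sub>F N in sequentially. (real (c N) / real (\<kappa> N)) / (real N / real (\<kappa> N)) = real (c N) / real N"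
    using lim[unfolded filterlim_at_top, rule_format, of 1] by eventually_elim simp
  ultimately show ?thesis by (rule Lim_transform_eventually)
qed

lemma emp_freq_tendsto:
  assumes "recurrent x" "admits_freqs x" "factor x w"
  shows "emp_freq x w \<longlonglongrightarrow> freq x w"
  using assms by (auto simp: recurrent_def admits_freqs_def freq_def convergent_LIMSEQ_iff)

abbreviation factors :: "'a word \<Rightarrow> nat \<Rightarrow> 'a list set" where
  "factors x n \<equiv> {w. factor x w \<and> length w = n}"

text \<open>A function of the window is a linear combination of the indicators of the finitely many
  factors of length \<open>n\<close>, so its average is the same combination of their
  frequencies.\<close>

lemma window_average:
  fixes g :: "'a list \<Rightarrow> nat"
  assumes rec: "recurrent x" and freqs: "admits_freqs x" and fin: "finite (range x)"
  shows "(\<lambda>N. (\<Sum>k<N. real (g (x [k \<rightarrow> k + n]))) / real N) \<longlonglongrightarrow> (\<Sum>w\<in>factors x n. freq x w * real (g w))"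
proof -
  have fF: "finite (factors x n)" using fin by (rule finite_lists_range)
  have "real (g (x [k \<rightarrow> k + n])) = (\<Sum>w\<in>factors x n. of_bool (occurs_at x w k) * real (g w))" for k
  proof -
    have "of_bool (occurs_at x w k) * real (g w) = (if w = x [k \<rightarrow> k + n] then real (g w) else 0)"
      if "w \<in> factors x n" for w
      using that by (auto simp: occurs_at_def)
    then have "(\<Sum>w\<in>factors x n. of_bool (occurs_at x w k) * real (g w)) =
        (\<Sum>w\<in>factors x n. if w = x [k \<rightarrow> k + n] then real (g w) else 0)"
      by (rule sum.cong[OF refl])
    also have "\<dots> = real (g (x [k \<rightarrow> k + n]))"
      using fF factor_subsequence[of x k n] by simp
    finally show ?thesis ..
  qed
  then have "(\<Sum>k<N. real (g (x [k \<rightarrow> k + n]))) / real N = (\<Sum>w\<in>factors x n. emp_freq x w N * real (g w))" for N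
    by (simp add: emp_freq_eq_average sum_divide_distrib sum_distrib_right sum.swap[of _ "{..<N}"] del: sum_of_bool_eq)
  then show ?thesis
    using emp_freq_tendsto[OF rec freqs] by (auto intro!: tendsto_intros)
qed


section \<open>Frequencies of the output word\<close>

text \<open>The state reached after reading \<open>w\<close>, given that every occurrence of \<open>u\<close> leads to \<open>q\<close>;
  the value is \<open>q\<close> if \<open>u\<close> does not occur in \<open>w\<close>.\<close>

definition state_after :: "('q, 'a, 'b) transducer \<Rightarrow> 'a list \<Rightarrow> 'q \<Rightarrow> 'a list \<Rightarrow> 'q" where
  "state_after A u q w =
     (case filter (\<lambda>p. take (length u) (drop p w) = u) [0..<length w] of
        [] \<Rightarrow> q | p # _ \<Rightarrow> trans_word A (drop (p + length u) w) q)"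

text \<open>The number of occurrences of \<open>v\<close> in the output that start while the letter at position \<open>m\<close>
  of the window \<open>w\<close> is read.\<close>

definition block_count ::
  "('q, 'a, 'b) transducer \<Rightarrow> 'a list \<Rightarrow> 'q \<Rightarrow> nat \<Rightarrow> 'b list \<Rightarrow> 'a list \<Rightarrow> nat" where
  "block_count A u q m v w =
     (let q' = state_after A u q (take m w); w' = drop m w
      in length (filter (\<lambda>p. take (length v) (drop p (outs A q' w')) = v)
           [0..<length (outs A q' (take 1 w'))]))"

context synced_run begin

abbreviation "past \<equiv> l + max_return x l"

lemma state_after_eq: "state_after A u (run A x (i + l)) (x [t \<rightarrow> t + past]) = run A x (t + past)"
proof -
  let ?w = "x [t \<rightarrow> t + past]"
  let ?ps = "filter (\<lambda>p. take (length u) (drop p ?w) = u) [0..<length ?w]"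
  obtain j where j: "t \<le> j" "j < t + max_return x l" "occurs_at x u j"
    using gap_subsequence[of i l] unfolding gap_bound_def by blast
  then have "take (length u) (drop (j - t) ?w) = u" "j - t < length ?w"
    by (simp_all add: occurs_at_def min_def)
  then have "?ps \<noteq> []" by (auto simp: filter_empty_conv)
  then obtain p ps where ps: "?ps = p # ps" by (cases ?ps) auto
  then have "p \<in> set ?ps" by simp
  then have p: "take l (drop p ?w) = u" "p < past" by simp_all
  \<comment> \<open>Comparing lengths excludes a match cut off by the end of the window.\<close>
  from arg_cong[OF p(1), of length] have pl: "p + l \<le> past" using p(2) by (simp add: min_def split: if_splits)
  have "occurs_at x u (t + p)" using p(1) pl by (simp add: occurs_at_def min_def ac_simps)
  then have "run A x (t + p + l) = run A x (i + l)" by (rule run_synced)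
  moreover have "drop (p + l) ?w = x [t + p + l \<rightarrow> t + p + l + (past - (p + l))]"
    using pl by (simp add: ac_simps)
  ultimately have "trans_word A (drop (p + l) ?w) (run A x (i + l)) = run A x (t + p + l + (past - (p + l)))"
    by (simp add: run_add)
  then show ?thesis using ps pl by (simp add: state_after_def ac_simps)
qed

lemma width_eq: "width n = past + (1 + K * n)"
  by (simp add: width_def)

lemma block_count_eq:
  "block_count A u (run A x (i + l)) past v (x [t \<rightarrow> t + width (length v)]) =
   card {p. P (t + past) \<le> p \<and> p < P (Suc (t + past)) \<and> occurs_at Y v p}"
proof -
  let ?k = "t + past" and ?m = "1 + K * length v"
  let ?o = "outs A (run A x ?k) (x [?k \<rightarrow> ?k + ?m])"
  have w: "take past (x [t \<rightarrow> t + width (length v)]) = x [t \<rightarrow> t + past]"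
    "drop past (x [t \<rightarrow> t + width (length v)]) = x [?k \<rightarrow> ?k + ?m]"
    "take 1 (x [?k \<rightarrow> ?k + ?m]) = x [?k \<rightarrow> ?k + 1]"
    by (simp_all add: width_eq min_def ac_simps del: subseq_to_Suc)
  have "length (outs A (run A x ?k) (x [?k \<rightarrow> ?k + 1])) = P (Suc ?k) - P ?k"
    using out_prefix_add[of A x ?k 1] by simp
  then have "block_count A u (run A x (i + l)) past v (x [t \<rightarrow> t + width (length v)]) =
      length (filter (\<lambda>e. take (length v) (drop e ?o) = v) [0..<P (Suc ?k) - P ?k])"
    by (simp only: block_count_def Let_def w state_after_eq)
  also have "\<dots> = card {e. e < P (Suc ?k) - P ?k \<and> take (length v) (drop e ?o) = v}"
    by (subst distinct_card[symmetric]) (auto intro!: arg_cong[of _ _ card])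
  also have "{e. e < P (Suc ?k) - P ?k \<and> take (length v) (drop e ?o) = v} =
      {e. e < P (Suc ?k) - P ?k \<and> occurs_at Y v (P ?k + e)}"
  proof (intro Collect_cong conj_cong refl)
    fix e assume "e < P (Suc ?k) - P ?k"
    then have "e + length v \<le> length ?o"
      using P_growth[of "Suc ?k" "length v"] out_prefix_add[of A x ?k ?m] by simp
    then show "take (length v) (drop e ?o) = v \<longleftrightarrow> occurs_at Y v (P ?k + e)"
      by (rule occurs_at_output_word[symmetric])
  qed
  also have "card \<dots> = card ((\<lambda>e. P ?k + e) ` \<dots>)"
    by (rule card_image[symmetric]) (simp add: inj_on_def)
  also have "(\<lambda>e. P ?k + e) ` {e. e < P (Suc ?k) - P ?k \<and> occurs_at Y v (P ?k + e)} =
      {p. P ?k \<le> p \<and> p < P (Suc ?k) \<and> occurs_at Y v p}" (is "?f ` ?L = ?R")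
  proof (intro subset_antisym subsetI)
    fix p assume "p \<in> ?R"
    then show "p \<in> ?f ` ?L" by (intro image_eqI[of _ _ "p - P ?k"]) auto
  qed auto
  finally show ?thesis .
qed

text \<open>The mean number of occurrences of \<open>v\<close> that start in the block of one input
  letter. Every position is an occurrence of \<open>[]\<close>, so \<open>rate []\<close> is the
  mean block length.\<close>

definition rate :: "'b list \<Rightarrow> real" where
  "rate v = (\<Sum>w\<in>factors x (width (length v)). freq x w * real (block_count A u (run A x (i + l)) past v w))"

lemma card_occurrences_P:
  "card {p. p < P k \<and> occurs_at Y v p} =
   (\<Sum>j<k. card {p. P j \<le> p \<and> p < P (Suc j) \<and> occurs_at Y v p})"
proof (induction k)
  case (Suc k)
  have "{p. p < P (Suc k) \<and> occurs_at Y v p} =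
      {p. p < P k \<and> occurs_at Y v p} \<union> {p. P k \<le> p \<and> p < P (Suc k) \<and> occurs_at Y v p}"
    using out_length_mono[of k "Suc k" A x] by auto
  moreover have "card ({p. p < P k \<and> occurs_at Y v p} \<union> {p. P k \<le> p \<and> p < P (Suc k) \<and> occurs_at Y v p}) =
      card {p. p < P k \<and> occurs_at Y v p} + card {p. P k \<le> p \<and> p < P (Suc k) \<and> occurs_at Y v p}"
    by (rule card_Un_disjoint) auto
  ultimately show ?case using Suc by (simp only: sum.lessThan_Suc)
qed (simp add: P_0)

lemma rate_tendsto:
  assumes freqs: "admits_freqs x"
  shows "(\<lambda>k. real (card {p. p < P k \<and> occurs_at Y v p}) / real k) \<longlonglongrightarrow> rate v"
proof -
  let ?f = "\<lambda>j. real (card {p. P j \<le> p \<and> p < P (Suc j) \<and> occurs_at Y v p})"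
  have "recurrent x" using ur by (simp add: uniformly_recurrent_def)
  from window_average[OF this freqs fin, of "block_count A u (run A x (i + l)) past v" "width (length v)"]
  have "(\<lambda>N. (\<Sum>k<N. ?f (k + past)) / real N) \<longlonglongrightarrow> rate v"
    unfolding block_count_eq rate_def .
  then have "(\<lambda>N. (\<Sum>k<N. ?f k) / real N) \<longlonglongrightarrow> rate v" unfolding average_shift_iff[of ?f past] .
  then show ?thesis unfolding card_occurrences_P of_nat_sum .
qed

lemma rate_Nil_tendsto:
  assumes freqs: "admits_freqs x"
  shows "(\<lambda>k. real (P k) / real k) \<longlonglongrightarrow> rate []"
  using rate_tendsto[OF freqs, of "[]"] by (simp add: occurs_at_iff)

text \<open>Any \<open>K\<close> letters yield at least one output symbol, so the limit, taken along
  multiples of \<open>K\<close>, is at least \<open>1 / real K\<close>.\<close>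

lemma rate_Nil_pos:
  assumes freqs: "admits_freqs x"
  shows "0 < rate []"
proof -
  have "strict_mono (\<lambda>n. K * Suc n)" using K_pos by (simp add: strict_mono_Suc_iff)
  from LIMSEQ_subseq_LIMSEQ[OF rate_Nil_tendsto[OF freqs] this]
  have "(\<lambda>n. real (P (K * Suc n)) / real (K * Suc n)) \<longlonglongrightarrow> rate []" by (simp add: o_def)
  moreover have "1 / real K \<le> real (P (K * Suc n)) / real (K * Suc n)" for n
  proof -
    have "Suc n \<le> P (K * Suc n)" using P_growth[of 0 "Suc n"] by simp
    then have "real (Suc n) / real (K * Suc n) \<le> real (P (K * Suc n)) / real (K * Suc n)"
      by (intro divide_right_mono) linarith+
    moreover have "real (Suc n) / real (K * Suc n) = 1 / real K"
      unfolding of_nat_mult using of_nat_neq_0[of n, where ?'a = real] by (simp del: of_nat_Suc)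
    ultimately show ?thesis by (simp only:)
  qed
  ultimately have "1 / real K \<le> rate []" by (intro LIMSEQ_le_const) auto
  then show ?thesis using K_pos by (smt (verit) divide_pos_pos of_nat_0_less_iff)
qed

lemma emp_freq_y_tendsto:
  assumes freqs: "admits_freqs x"
  shows "emp_freq y v \<longlonglongrightarrow> rate v / rate []"
proof -
  let ?c = "\<lambda>N. card {p. p < N \<and> occurs_at Y v p}"
  have "{p. p < Suc N \<and> occurs_at Y v p} =
      (if occurs_at Y v N then insert N {p. p < N \<and> occurs_at Y v p} else {p. p < N \<and> occurs_at Y v p})" for N
    by (auto simp: less_Suc_eq)
  then have "?c N \<le> ?c (Suc N) \<and> ?c (Suc N) \<le> Suc (?c N)" for N by simp
  then have "(\<lambda>N. real (?c N) / real N) \<longlonglongrightarrow> rate v / rate []"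
    using P_Suc_le P_unbounded rate_Nil_pos[OF freqs]
    by (intro block_average_quotient[of ?c P C] P_0 rate_tendsto[OF freqs] rate_Nil_tendsto[OF freqs])
      (auto intro: monoI out_length_mono)
  then have "emp_freq Y v \<longlonglongrightarrow> rate v / rate []" by (simp add: emp_freq_def[abs_def])
  then have "(\<lambda>N. (\<Sum>k<N. of_bool (occurs_at Y v (k + P (i + l)))) / real N) \<longlonglongrightarrow> rate v / rate []"
    unfolding average_shift_iff[of "\<lambda>k. of_bool (occurs_at Y v k)"] emp_freq_eq_average[abs_def] .
  moreover have "occurs_at y v k = occurs_at Y v (k + P (i + l))" for k
    by (simp add: occurs_at_iff ac_simps)
  ultimately show ?thesis by (simp only: emp_freq_eq_average[abs_def])
qed

lemma admits_freqs_y: "admits_freqs x \<Longrightarrow> admits_freqs y"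
  unfolding admits_freqs_def[of y] using emp_freq_y_tendsto by (blast intro: convergentI)

lemma freq_y: "admits_freqs x \<Longrightarrow> freq y v = rate v / rate []"
  unfolding freq_def using emp_freq_y_tendsto by (rule limI)

end


section \<open>Effective transduction\<close>

lemma computes_iff: "(\<exists>p. computes p f) \<longleftrightarrow> computable f"
  by (simp add: computes_def computable_def enc_nat_def)

lemma computable_subsequence [computable_intros]:
  assumes "computable x" "computable f" "computable g"
  shows "computable (\<lambda>a. x [f a \<rightarrow> g a])"
  unfolding subsequence_def by (intro computable_intros assms(2,3) computable_compose[OF assms(1)])

lemma computable_occurs_at [computable_intros]:
  assumes "computable x" "computable u" "computable j"
  shows "computable (\<lambda>a. occurs_at x (u a) (j a))"
  unfolding occurs_at_def by (intro computable_intros assms)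

lemma computable_consecutive [computable_intros]:
  assumes "computable x" "computable u" "computable j" "computable d"
  shows "computable (\<lambda>a. consecutive x (u a) (j a) (d a))"
proof -
  have "computable (\<lambda>t. u (fst t))" "computable (\<lambda>t. j (fst t))"
    by (intro computable_compose[OF assms(2)] computable_compose[OF assms(3)] computable_intros)+
  then show ?thesis unfolding consecutive_def by (intro computable_intros assms)
qed

text \<open>Any computable gap bound will do for \<open>W\<close>: it yields a prefix long enough to
  find the exact maximum.\<close>

lemma computable_max_return:
  assumes y: "computable y" and W: "computable W"
    and gap: "\<And>u. factor y u \<Longrightarrow> gap_bound y u (W (length u))"
  shows "computable (max_return y)"
proof (rule computable_cong)
  show "computable (\<lambda>n. foldl max 0 (concat (map (\<lambda>i. filter (\<lambda>d. consecutive y (y [i \<rightarrow> i + n]) i d)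
      [0..<Suc (W n)]) [0..<W (W n + n)])))"
    by (intro computable_foldl_max computable_intros y computable_compose[OF W])
qed (rule max_return_computation[OF gap])

lemma foldl_outs:
  "foldl (\<lambda>s a. (trans_fun A (fst s) a, snd s @ out_fun A (fst s) a)) (q, z) w =
   (trans_word A w q, z @ outs A q w)"
  by (induction w arbitrary: q z) (simp_all add: trans_word_def)

lemma computable_trans_word:
  assumes "computable (\<lambda>t. trans_fun (B (fst t)) (fst (snd t)) (snd (snd t)))"
    "computable q" "computable w"
  shows "computable (\<lambda>a. trans_word (B a) (w a) (q a))"
  unfolding trans_word_def by (intro computable_intros assms)

lemma computable_outs:
  assumes t: "computable (\<lambda>t. trans_fun (B (fst t)) (fst (snd t)) (snd (snd t)))"
    and o: "computable (\<lambda>t. out_fun (B (fst t)) (fst (snd t)) (snd (snd t)))"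
    and "computable q" "computable w"
  shows "computable (\<lambda>a. outs (B a) (q a) (w a))"
proof (rule computable_cong)
  show "computable (\<lambda>a. snd (foldl (\<lambda>s b. (trans_fun (B a) (fst s) b, snd s @ out_fun (B a) (fst s) b))
      (q a, []) (w a)))"
    by (intro computable_intros assms(3,4)
      computable_compose[OF t, of "\<lambda>t. (fst t, fst (fst (snd t)), snd (snd t))", simplified]
      computable_compose[OF o, of "\<lambda>t. (fst t, fst (fst (snd t)), snd (snd t))", simplified])
qed (simp add: foldl_outs)

text \<open>Outside its states and letters the functions of a transducer are arbitrary, possibly not
  computable. A run sees only the values compared here, so \<open>A\<close> can be exchanged for a
  tabulated or decoded copy.\<close>

definition agree :: "('q, 'a, 'b) transducer \<Rightarrow> ('q, 'a, 'b) transducer \<Rightarrow> bool" where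
  "agree A B \<longleftrightarrow> initial B = initial A \<and>
     (\<forall>q\<in>states A. \<forall>a\<in>in_alph A. trans_fun B q a = trans_fun A q a \<and> out_fun B q a = out_fun A q a)"

lemma run_agree:
  assumes "agree A B" "wf_transducer A" "range x \<subseteq> in_alph A"
  shows "run B x n = run A x n"
proof (induction n)
  case (Suc n)
  then show ?case using assms run_in_states[OF assms(2,3), of n] by (auto simp: agree_def)
qed (use assms in \<open>simp add: agree_def\<close>)

lemma out_prefix_agree:
  assumes "agree A B" "wf_transducer A" "range x \<subseteq> in_alph A"
  shows "out_prefix B x n = out_prefix A x n"
proof -
  have "out_fun B (run B x k) (x k) = out_fun A (run A x k) (x k)" for k
    using assms run_in_states[OF assms(2,3), of k] by (auto simp: agree_def run_agree[OF assms])
  then show ?thesis by (simp add: out_prefix_def)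
qed

lemma output_word_agree:
  assumes "agree A B" "wf_transducer A" "range x \<subseteq> in_alph A"
  shows "output_word B x = output_word A x"
  by (simp add: output_word_def[abs_def] out_prefix_agree[OF assms])

definition tabulate :: "(nat, nat, nat) transducer \<Rightarrow> (nat, nat, nat) transducer" where
  "tabulate A = A\<lparr>
     trans_fun := \<lambda>q a. if (q, a) \<in> states A \<times> in_alph A then trans_fun A q a else 0,
     out_fun := \<lambda>q a. if (q, a) \<in> states A \<times> in_alph A then out_fun A q a else []\<rparr>"

lemma agree_tabulate: "agree A (tabulate A)"
  by (simp add: agree_def tabulate_def)

lemma wf_tabulate: "wf_transducer A \<Longrightarrow> wf_transducer (tabulate A)"
  by (simp add: wf_transducer_def tabulate_def)

lemma computable_tabulate:
  assumes "wf_transducer A"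
  shows "computable (\<lambda>t. trans_fun (tabulate A) (fst t) (snd t))"
    and "computable (\<lambda>t. out_fun (tabulate A) (fst t) (snd t))"
proof -
  have "finite (states A \<times> in_alph A)" using assms by (simp add: wf_transducer_def)
  from computable_finite_table[OF this, of "\<lambda>t. trans_fun A (fst t) (snd t)" 0]
    computable_finite_table[OF this, of "\<lambda>t. out_fun A (fst t) (snd t)" "[]"]
  show "computable (\<lambda>t. trans_fun (tabulate A) (fst t) (snd t))"
    "computable (\<lambda>t. out_fun (tabulate A) (fst t) (snd t))"
    by (simp_all add: tabulate_def mem_Times_iff)
qed


section \<open>Approximation of frequencies\<close>

text \<open>Scales the rational coded by \<open>r\<close> by \<open>Suc n\<close> and rounds down.
  Even first components code the non-negative integers; negative values are replaced by 0, which is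
  closer to any non-negative frequency.\<close>

definition nat_approx :: "nat \<Rightarrow> nat \<Rightarrow> nat" where
  "nat_approx r n = (if 2 * (fst (prod_decode r) div 2) = fst (prod_decode r)
     then (fst (prod_decode r) div 2 * Suc n) div Suc (snd (prod_decode r)) else 0)"

text \<open>Scaling turns the tolerance into an error below 1, and rounding down adds less than
  1.\<close>

lemma nat_approx:
  fixes f :: real
  assumes f: "0 \<le> f" and r: "\<bar>f - of_rat (rat_of_code r)\<bar> < 1 / real (Suc n)"
  shows "\<bar>f * real (Suc n) - real (nat_approx r n)\<bar> \<le> 2"
proof -
  obtain a b where ab: "prod_decode r = (a, b)" by fastforce
  have val: "of_rat (rat_of_code r) = (of_int (int_decode a) / real (Suc b) :: real)"
    by (simp add: rat_of_code_def ab of_rat_divide of_rat_add)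
  have mult: "\<bar>f * real (Suc n) - of_int (int_decode a) / real (Suc b) * real (Suc n)\<bar> < 1"
  proof -
    define c where "c = of_int (int_decode a) / real (Suc b)"
    have "\<bar>f - c\<bar> * real (Suc n) < 1"
      using r unfolding val c_def[symmetric] by (simp add: pos_less_divide_eq del: of_nat_Suc)
    then have "\<bar>f * real (Suc n) - c * real (Suc n)\<bar> < 1"
      unfolding left_diff_distrib[symmetric] abs_mult by simp
    then show ?thesis unfolding c_def .
  qed
  show ?thesis
  proof (cases "even a")
    case True
    define k where "k = a div 2"
    have k: "int_decode a = int k" using True by (simp add: int_decode_def sum_decode_def k_def)
    have na: "nat_approx r n = (k * Suc n) div Suc b"
      using True by (simp add: nat_approx_def ab k_def)
    define d m where "d = (k * Suc n) div Suc b" and "m = (k * Suc n) mod Suc b"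
    have "k * Suc n = d * Suc b + m" "m < Suc b"
      unfolding d_def m_def by (rule div_mult_mod_eq[symmetric], rule mod_less_divisor) simp
    then have "real k * real (Suc n) = real d * real (Suc b) + real m" "real m < real (Suc b)"
      by (metis of_nat_mult of_nat_add, metis of_nat_less_iff)
    moreover define \<mu> where "\<mu> = real m / real (Suc b)"
    ultimately have "real k * real (Suc n) / real (Suc b) = real d + \<mu>" "\<mu> < 1" "0 \<le> \<mu>"
      by (simp_all add: add_divide_distrib del: of_nat_Suc)
    then have \<mu>: "of_int (int_decode a) / real (Suc b) * real (Suc n) = real d + \<mu>" "\<mu> < 1" "0 \<le> \<mu>"
      by (simp_all add: k del: of_nat_Suc)
    show ?thesis using mult \<mu>(2,3) unfolding na d_def[symmetric] \<mu>(1) by linarith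
  next
    case False
    then have "int_decode a < 0" by (simp add: int_decode_def sum_decode_def)
    then have "of_int (int_decode a) / real (Suc b) * real (Suc n) \<le> 0"
      by (intro mult_nonpos_nonneg divide_nonpos_nonneg) simp_all
    moreover have "nat_approx r n = 0" using False by (auto simp: nat_approx_def ab)
    moreover have "0 \<le> f * real (Suc n)" using f by simp
    ultimately show ?thesis using mult by simp
  qed
qed

text \<open>Interval arithmetic for \<open>a / b\<close>: the scaled approximations are trusted as soon as the
  enclosing interval is shorter than \<open>1 / m\<close>.\<close>

definition accurate :: "nat \<Rightarrow> nat \<Rightarrow> nat \<Rightarrow> nat \<Rightarrow> nat \<Rightarrow> bool" where
  "accurate N e D e' m \<longleftrightarrow> e' < D \<and>
     (N + e) * (D + e') * m < (D - e') * (D + e') + (N - e) * (D - e') * m"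

lemma accurate_sound:
  fixes a b :: real
  assumes acc: "accurate N e D e' m" and m: "0 < m" and a: "0 \<le> a" and s: "0 < s"
    and N: "\<bar>a * s - real N\<bar> \<le> real e" and D: "\<bar>b * s - real D\<bar> \<le> real e'"
  shows "\<bar>a / b - real (N + e) / real (D - e')\<bar> < 1 / real m"
proof -
  have eD: "e' < D" using acc by (simp add: accurate_def)
  define lo hi dl dh where "lo = real (N - e)" "hi = real (N + e)" "dl = real (D - e')" "dh = real (D + e')"
  note defs = lo_hi_dl_dh_def
  have dl: "0 < dl" "0 < dh" using eD by (simp_all add: defs)
  \<comment> \<open>If \<open>e\<close> exceeds \<open>N\<close>, the truncated difference is 0,
    still a lower bound because \<open>0 \<le> a\<close>.\<close>
  have as: "lo \<le> a * s" "a * s \<le> hi"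
    using N a s unfolding defs by (auto simp: of_nat_diff_if abs_le_iff) 
  have bs: "dl \<le> b * s" "b * s \<le> dh" using D eD unfolding defs by (simp_all add: abs_le_iff of_nat_diff)
  have "0 \<le> hi" "0 \<le> lo" by (simp_all add: defs)
  have q: "a / b = (a * s) / (b * s)" using s by simp
  have "lo / dh \<le> a / b" unfolding q using as bs dl \<open>0 \<le> lo\<close> by (intro frac_le) auto
  moreover have "a / b \<le> hi / dl" unfolding q using as bs dl \<open>0 \<le> hi\<close> by (intro frac_le) auto
  moreover have "hi / dl - lo / dh < 1 / real m"
  proof -
    \<comment> \<open>The inequality in \<open>accurate\<close> is the claim with the denominators
      cleared.\<close>
    have "hi * dh * real m < dl * dh + lo * dl * real m"
      using acc unfolding accurate_def defs of_nat_mult[symmetric] of_nat_add[symmetric] of_nat_less_iff by blast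
    then have "(hi * dh - lo * dl) * real m < dl * dh" by (simp add: algebra_simps)
    then have "(hi * dh - lo * dl) / (dl * dh) < 1 / real m"
      using dl m by (simp add: field_simps)
    then show ?thesis using dl by (simp add: diff_frac_eq mult.commute)
  qed
  ultimately show ?thesis unfolding defs[symmetric] by linarith
qed

lemma tendsto_scaled:
  fixes a :: real
  assumes "\<And>n. \<bar>a * real (Suc n) - real (N n)\<bar> \<le> real e"
  shows "(\<lambda>n. real (N n) / real (Suc n)) \<longlonglongrightarrow> a"
proof -
  have "norm (real (N n) / real (Suc n) - a) \<le> real e / real (Suc n)" for n
  proof -
    have "real (N n) / real (Suc n) - a = (real (N n) - a * real (Suc n)) / real (Suc n)"
      by (simp add: field_simps)
    then show ?thesis using assms[of n] by (simp add: divide_right_mono abs_minus_commute del: of_nat_Suc)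
  qed
  then have "(\<lambda>n. real (N n) / real (Suc n) - a) \<longlonglongrightarrow> 0"
    by (intro tendsto_0_le[OF LIMSEQ_Suc[OF lim_const_over_n[of "real e"]], where K = 1]) simp
  then show ?thesis by (simp add: LIM_zero_cancel)
qed

text \<open>The errors \<open>e\<close> and \<open>e'\<close> do not grow with the scale. Divided by
  the square of the scale, the difference of the two sides therefore tends to \<open>b * b\<close>,
  which is positive.\<close>

lemma accurate_exists:
  fixes a b :: real
  assumes b: "0 < b"
    and N: "\<And>n. \<bar>a * real (Suc n) - real (N n)\<bar> \<le> real e"
    and D: "\<And>n. \<bar>b * real (Suc n) - real (D n)\<bar> \<le> real e'"
  shows "\<exists>n. accurate (N n) e (D n) e' m"
proof -
  let ?s = "\<lambda>n. real (Suc n)"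
  define p q where "p n = real (N n) / ?s n" and "q n = real (D n) / ?s n" for n
  define \<epsilon> \<epsilon>' where "\<epsilon> n = real e / ?s n" and "\<epsilon>' n = real e' / ?s n" for n
  have p: "p \<longlonglongrightarrow> a" unfolding p_def using N by (rule tendsto_scaled)
  have q: "q \<longlonglongrightarrow> b" unfolding q_def using D by (rule tendsto_scaled)
  have eps: "\<epsilon> \<longlonglongrightarrow> 0" "\<epsilon>' \<longlonglongrightarrow> 0"
    unfolding \<epsilon>_def \<epsilon>'_def by (intro LIMSEQ_Suc[OF lim_const_over_n])+
  have "(\<lambda>n. q n - \<epsilon>' n) \<longlonglongrightarrow> b - 0" by (intro tendsto_intros q eps)
  then have ev1: "\<forall>\<^sub>F n in sequentially. 0 < q n - \<epsilon>' n" using b by (intro order_tendstoD) auto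
  have lim: "(\<lambda>n. (q n - \<epsilon>' n) * (q n + \<epsilon>' n) + (p n - \<epsilon> n) * (q n - \<epsilon>' n) * m - (p n + \<epsilon> n) * (q n + \<epsilon>' n) * m)
      \<longlonglongrightarrow> (b - 0) * (b + 0) + (a - 0) * (b - 0) * m - (a + 0) * (b + 0) * m"
    by (intro tendsto_intros p q eps)
  have ev2: "\<forall>\<^sub>F n in sequentially. 0 < (q n - \<epsilon>' n) * (q n + \<epsilon>' n) + (p n - \<epsilon> n) * (q n - \<epsilon>' n) * m
      - (p n + \<epsilon> n) * (q n + \<epsilon>' n) * m"
    using order_tendstoD(1)[OF lim, of 0] b by simp
  obtain n where n: "0 < q n - \<epsilon>' n" "0 < (q n - \<epsilon>' n) * (q n + \<epsilon>' n) + (p n - \<epsilon> n) * (q n - \<epsilon>' n) * m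
      - (p n + \<epsilon> n) * (q n + \<epsilon>' n) * m"
    using eventually_happens[OF eventually_conj[OF ev1 ev2]] by auto
  have s: "0 < ?s n" by simp
  have scale: "real (N n) = p n * ?s n" "real (D n) = q n * ?s n" "real e = \<epsilon> n * ?s n" "real e' = \<epsilon>' n * ?s n"
    using s by (simp_all add: p_def q_def \<epsilon>_def \<epsilon>'_def del: of_nat_Suc)
  have "real e' < real (D n)" unfolding scale using n(1) s by (intro mult_strict_right_mono) simp_all
  then have D': "e' < D n" by simp
  have "0 < ((q n - \<epsilon>' n) * (q n + \<epsilon>' n) + (p n - \<epsilon> n) * (q n - \<epsilon>' n) * m
      - (p n + \<epsilon> n) * (q n + \<epsilon>' n) * m) * (?s n * ?s n)"
    using n(2) s by (intro mult_pos_pos)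
  also have "\<dots> = (real (D n) - real e') * (real (D n) + real e') + (real (N n) - real e) * (real (D n) - real e') * m
      - (real (N n) + real e) * (real (D n) + real e') * m"
    unfolding scale by (simp add: algebra_simps del: of_nat_Suc)
  finally have "(real (N n) + real e) * (real (D n) + real e') * m <
      (real (D n) - real e') * (real (D n) + real e') + (real (N n) - real e) * (real (D n) - real e') * m"
    by simp
  \<comment> \<open>Truncating \<open>N n - e\<close> at 0 can only enlarge this side.\<close>
  also have "\<dots> \<le> real (D n - e') * real (D n + e') + real (N n - e) * real (D n - e') * m"
    using D' by (intro add_mono mult_right_mono) (auto simp: of_nat_diff_if)
  finally have "real ((N n + e) * (D n + e') * m) < real ((D n - e') * (D n + e') + (N n - e) * (D n - e') * m)"
    by simp
  then show ?thesis using D' unfolding accurate_def of_nat_less_iff by blast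
qed


section \<open>Programs for the suffix\<close>

locale effective_synced_run = synced_run A x i l
  for A :: "(nat, nat, nat) transducer" and x :: "nat word" and i l :: nat +
  fixes p_freq :: prog
  assumes trans_computable: "computable (\<lambda>t. trans_fun A (fst t) (snd t))"
    and out_computable: "computable (\<lambda>t. out_fun A (fst t) (snd t))"
    and x_computable: "computable x"
    and return_computable: "computable (max_return x)"
    and freqs: "admits_freqs x"
    and freq_prog: "computes_freqs p_freq x"
begin

lemmas comp_trans_word = computable_trans_word[of "\<lambda>_. A",
    OF computable_compose[OF trans_computable, of "\<lambda>t. snd t", simplified]]
lemmas comp_outs = computable_outs[of "\<lambda>_. A",
    OF computable_compose[OF trans_computable, of "\<lambda>t. snd t", simplified]
       computable_compose[OF out_computable, of "\<lambda>t. snd t", simplified]]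

lemma computable_y: "computable y"
proof (rule computable_cong)
  let ?s = "P (i + l)"
  show "computable (\<lambda>p. nth0 (outs A (initial A) (x [0 \<rightarrow> K * Suc (?s + p)])) (?s + p))"
    by (intro computable_intros comp_outs x_computable)
  show "y p = nth0 (outs A (initial A) (x [0 \<rightarrow> K * Suc (?s + p)])) (?s + p)" for p
  proof -
    have "?s + p < P (K * Suc (?s + p))" using P_growth[of 0 "Suc (?s + p)"] by simp
    then show ?thesis using out_prefix_nth[of "?s + p" A x] by (simp add: nth0_def out_prefix_eq)
  qed
qed

lemma computable_width [computable_intros]:
  "computable f \<Longrightarrow> computable (\<lambda>a. width (f a))"
  unfolding width_def by (intro computable_intros)

lemma computable_y_gap: "computable y_gap"
  unfolding y_gap_def[abs_def]
  by (intro computable_intros computable_compose[OF return_computable])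

lemma effectively_uniformly_recurrent_y: "effectively_uniformly_recurrent y"
  unfolding effectively_uniformly_recurrent_def computes_iff
  using uniformly_recurrent_y computable_y
    computable_max_return[OF computable_y computable_y_gap gap_bound_y]
  by blast

definition factor_list :: "nat \<Rightarrow> nat list list" where
  "factor_list n = map (\<lambda>j. x [j \<rightarrow> j + n]) [0..<max_return x n]"

text \<open>By the gap bound every factor of length \<open>n\<close> has an occurrence below
  \<open>max_return x n\<close>.\<close>

lemma set_factor_list: "set (factor_list n) = factors x n"
proof (intro subset_antisym subsetI)
  fix w assume "w \<in> factors x n"
  then obtain j where "j < max_return x n" "occurs_at x w j"
    using gap[of w] unfolding gap_bound_def by (metis (mono_tags) add_0 mem_Collect_eq)
  with \<open>w \<in> factors x n\<close> show "w \<in> set (factor_list n)"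
    by (auto simp: factor_list_def occurs_at_def intro!: image_eqI[of _ _ j])
qed (auto simp: factor_list_def factor_subsequence)

lemma computable_factor_list [computable_intros]:
  "computable f \<Longrightarrow> computable (\<lambda>a. factor_list (f a))"
  unfolding factor_list_def
  by (intro computable_intros x_computable computable_compose[OF return_computable]
    computable_compose[of f, OF _ computable_fst[OF computable_id]])

text \<open>\<open>prod_encode (2, n)\<close> codes the tolerance \<open>1 / (n + 1)\<close>, since
  \<open>int_decode 2\<close> is 1.\<close>

definition approx_code :: "nat list \<Rightarrow> nat \<Rightarrow> nat" where
  "approx_code w n = (SOME r. eval p_freq [list_encode w, prod_encode (2, n)] r \<and>
     \<bar>freq x w - of_rat (rat_of_code r)\<bar> < 1 / real (Suc n))"

lemma approx_code:
  assumes "factor x w"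
  shows "eval p_freq [list_encode w, prod_encode (2, n)] (approx_code w n)"
    and "\<bar>freq x w - of_rat (rat_of_code (approx_code w n))\<bar> < 1 / real (Suc n)"
proof -
  have "infinite {j. occurs_at x w j}"
    using ur assms by (simp add: uniformly_recurrent_def recurrent_def)
  moreover have d: "rat_of_code (prod_encode (2, n)) = 1 / of_nat (Suc n)"
    by (simp add: rat_of_code_def int_decode_def sum_decode_def)
  moreover have "of_rat (1 / of_nat (Suc n)) = 1 / real (Suc n)"
    by (simp add: of_rat_divide of_rat_add)
  ultimately have "\<exists>r. eval p_freq [list_encode w, prod_encode (2, n)] r \<and>
      \<bar>freq x w - of_rat (rat_of_code r)\<bar> < 1 / real (Suc n)"
    using freq_prog[unfolded computes_freqs_def, rule_format, of w "prod_encode (2, n)"]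
    by (simp del: of_nat_Suc)
  from someI_ex[OF this]
  show "eval p_freq [list_encode w, prod_encode (2, n)] (approx_code w n)"
    and "\<bar>freq x w - of_rat (rat_of_code (approx_code w n))\<bar> < 1 / real (Suc n)"
    by (auto simp: approx_code_def)
qed

text \<open>\<open>p_freq\<close> need not halt on words that are not factors, so membership is
  tested before its output is used.\<close>

definition approx :: "nat list \<Rightarrow> nat \<Rightarrow> nat" where
  "approx w n = nat_approx (if w \<in> set (factor_list (length w)) then approx_code w n else 0) n"

lemma freq_nonneg: "factor x w \<Longrightarrow> 0 \<le> freq x w"
  using emp_freq_tendsto[OF _ freqs] ur
  by (intro LIMSEQ_le_const[of "emp_freq x w"]) (auto simp: uniformly_recurrent_def emp_freq_def)

lemma approx: "factor x w \<Longrightarrow> \<bar>freq x w * real (Suc n) - real (approx w n)\<bar> \<le> 2"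
  using nat_approx[OF freq_nonneg approx_code(2)] by (simp add: approx_def set_factor_list del: of_nat_Suc)

lemma computable_approx [computable_intros]:
  assumes "computable f" "computable g"
  shows "computable (\<lambda>a. approx (f a) (g a))"
proof -
  obtain two where two: "\<And>xs. eval two xs 2" using eval_const by blast
  let ?q = "Comp p_freq [Fst_prog, Comp Pair_prog [two, Snd_prog]]"
  define h where "h t = (if fst t \<in> set (factor_list (length (fst t))) then approx_code (fst t) (snd t) else 0)" for t
  have "computable h"
    unfolding h_def
  proof (rule computable_if_lazy)
    show "computable (\<lambda>t :: nat list \<times> nat. fst t \<in> set (factor_list (length (fst t))))"
      by (intro computable_intros)
    show "computable (\<lambda>t :: nat list \<times> nat. 0 :: nat)" by (rule computable_const)
    fix t :: "nat list \<times> nat" assume "fst t \<in> set (factor_list (length (fst t)))"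
    then have "factor x (fst t)" by (simp add: set_factor_list)
    from approx_code(1)[OF this, of "snd t"]
    show "eval ?q [enc t] (enc (approx_code (fst t) (snd t)))"
      unfolding enc_prod_def enc_nat_list enc_nat_def
      by (rule eval_Comp2[OF eval_Fst_prog eval_Comp2[OF two eval_Snd_prog eval_Pair_prog]])
  qed
  then have "computable (\<lambda>t. approx (fst t) (snd t))"
    unfolding approx_def nat_approx_def h_def[symmetric] by (intro computable_intros)
  from computable_compose[OF this computable_Pair[OF assms]] show ?thesis by simp
qed

definition weight :: "nat list \<Rightarrow> nat list \<Rightarrow> nat" where
  "weight v w = block_count A u (run A x (i + l)) past v w"

lemma computable_weight [computable_intros]:
  assumes "computable f" "computable g"
  shows "computable (\<lambda>a. weight (f a) (g a))"
proof -
  have "computable (\<lambda>w. state_after A u (run A x (i + l)) w)"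
    unfolding state_after_def by (intro computable_intros comp_trans_word)
  note state = computable_compose[OF this]
  have "computable (\<lambda>t. weight (fst t) (snd t))"
    unfolding weight_def block_count_def Let_def by (intro computable_intros comp_outs state)
  from computable_compose[OF this computable_Pair[OF assms]] show ?thesis by simp
qed

definition rate_approx :: "nat list \<Rightarrow> nat \<Rightarrow> nat" where
  "rate_approx v n = sum_list (map (\<lambda>w. approx w n * weight v w) (remdups (factor_list (width (length v)))))"

text \<open>Each \<open>approx w n\<close> is off by at most 2, whatever \<open>n\<close> is; hence
  the error relative to the scale tends to 0.\<close>

definition rate_error :: "nat list \<Rightarrow> nat" where
  "rate_error v = sum_list (map (\<lambda>w. 2 * weight v w) (remdups (factor_list (width (length v)))))"

lemma sum_factor_list:
  "sum_list (map f (remdups (factor_list n))) = (\<Sum>w\<in>factors x n. f w)" for f :: "nat list \<Rightarrow> nat"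
  by (simp add: sum.set_conv_list[symmetric] set_factor_list sum_list_distinct_conv_sum_set)

lemma rate_approx: "\<bar>rate v * real (Suc n) - real (rate_approx v n)\<bar> \<le> real (rate_error v)"
proof -
  let ?F = "factors x (width (length v))"
  have "rate v * r = (\<Sum>w\<in>?F. freq x w * r * real (weight v w))" for r
    unfolding rate_def weight_def sum_distrib_right
    by (intro sum.cong refl) (simp only: mult_ac)
  moreover have "real (rate_approx v n) = (\<Sum>w\<in>?F. real (approx w n) * real (weight v w))"
    by (simp add: rate_approx_def sum_factor_list)
  ultimately have "rate v * real (Suc n) - real (rate_approx v n) =
      (\<Sum>w\<in>?F. (freq x w * real (Suc n) - real (approx w n)) * real (weight v w))"
    by (simp only: left_diff_distrib sum_subtractf)
  then have "\<bar>rate v * real (Suc n) - real (rate_approx v n)\<bar> =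
      \<bar>\<Sum>w\<in>?F. (freq x w * real (Suc n) - real (approx w n)) * real (weight v w)\<bar>"
    by (rule arg_cong)
  also have "\<dots> \<le> (\<Sum>w\<in>?F. 2 * real (weight v w))"
    using approx by (intro order.trans[OF sum_abs] sum_mono) (simp add: abs_mult mult_right_mono del: of_nat_Suc)
  also have "\<dots> = real (rate_error v)" by (simp add: rate_error_def sum_factor_list)
  finally show ?thesis .
qed

lemma rate_nonneg: "0 \<le> rate v"
  unfolding rate_def by (intro sum_nonneg mult_nonneg_nonneg) (auto intro: freq_nonneg)

lemma computable_rate_approx [computable_intros]:
  assumes "computable f" "computable g"
  shows "computable (\<lambda>a. rate_approx (f a) (g a))"
proof -
  have "computable (\<lambda>t. rate_approx (fst t) (snd t))"
    unfolding rate_approx_def by (intro computable_intros)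
  from computable_compose[OF this computable_Pair[OF assms]] show ?thesis by simp
qed

lemma computable_rate_error [computable_intros]:
  assumes "computable f"
  shows "computable (\<lambda>a. rate_error (f a))"
proof -
  have "computable (\<lambda>v. rate_error v)"
    unfolding rate_error_def by (intro computable_intros)
  from computable_compose[OF this assms] show ?thesis .
qed

text \<open>Scales are tried until the interval enclosing \<open>rate v / rate []\<close> is short
  enough; the search ends because \<open>rate []\<close> is positive.\<close>

lemma admits_computable_freqs_y: "admits_computable_freqs y"
proof -
  \<comment> \<open>A positive tolerance whose code has second component \<open>b\<close> is at
    least \<open>1 / Suc b\<close>.\<close>
  define good where "good t n \<longleftrightarrow> accurate (rate_approx (fst t) n) (rate_error (fst t))
    (rate_approx [] n) (rate_error []) (Suc (snd (prod_decode (snd t))))" for t :: "nat list \<times> nat" and n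
  \<comment> \<open>In a code of a rational, \<open>2 * k\<close> stands for the integer
    \<open>k\<close>, and the denominator is stored minus one.\<close>
  define result where "result t = (let n = LEAST n. good t n in
    prod_encode (2 * (rate_approx (fst t) n + rate_error (fst t)), rate_approx [] n - rate_error [] - Suc 0))"
    for t
  have good_ex: "\<exists>n. good t n" for t
    unfolding good_def using rate_approx rate_Nil_pos[OF freqs] by (intro accurate_exists) 
  have "computable (\<lambda>t. good (fst t) (snd t))"
    unfolding good_def accurate_def by (intro computable_intros)
  then have "computable (\<lambda>t. LEAST n. good t n)" using good_ex by (rule computable_Least)
  then have "computable (\<lambda>t. result t)"
    unfolding result_def Let_def by (intro computable_intros)
  then obtain p where p: "\<And>t. eval p [enc t] (result t)"
    by (rule computableE) (simp add: enc_nat_def, blast)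
  have "computes_freqs (Comp p [Pair_prog]) y"
    unfolding computes_freqs_def
  proof (intro allI impI)
    fix v d assume "infinite {j. occurs_at y v j} \<and> 0 < rat_of_code d"
    then have d: "0 < rat_of_code d" ..
    let ?n = "LEAST n. good (v, d) n" and ?r = "result (v, d)"
    obtain a b where ab: "prod_decode d = (a, b)" by fastforce
    have "eval Pair_prog [list_encode v, d] (enc (v, d))"
      using eval_Pair_prog by (simp add: enc_prod_def enc_nat_list enc_nat_def)
    then have ev: "eval (Comp p [Pair_prog]) [list_encode v, d] ?r" using p by (rule eval_Comp1)
    have "good (v, d) ?n" using good_ex by (rule LeastI_ex)
    then have acc: "accurate (rate_approx v ?n) (rate_error v) (rate_approx [] ?n) (rate_error []) (Suc b)"
      by (simp add: good_def ab)
    have pos: "0 < rate_approx [] ?n - rate_error []" using acc by (simp add: accurate_def)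
    define N where "N = rate_approx v ?n + rate_error v"
    obtain c where c: "rate_approx [] ?n - rate_error [] = Suc c" using pos by (auto simp: gr0_conv_Suc)
    have "rate_approx [] ?n - rate_error [] - Suc 0 = c" using c by simp
    then have "?r = prod_encode (2 * N, c)" by (simp only: result_def Let_def N_def fst_conv)
    then have "rat_of_code ?r = of_nat N / of_nat (Suc c)"
      by (simp add: rat_of_code_def int_decode_def sum_decode_def del: of_nat_Suc)
    then have val: "of_rat (rat_of_code ?r) =
        real (rate_approx v ?n + rate_error v) / real (rate_approx [] ?n - rate_error [])"
      unfolding c N_def[symmetric] by (simp only: of_rat_divide of_rat_of_nat_eq)
    have "\<bar>freq y v - of_rat (rat_of_code ?r)\<bar> < 1 / real (Suc b)"
      unfolding freq_y[OF freqs] val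
      by (rule accurate_sound[OF acc _ rate_nonneg _ rate_approx[of _ ?n] rate_approx[of _ ?n]]) simp_all
    also have "\<dots> \<le> of_rat (rat_of_code d)"
    proof -
      have "0 < int_decode a" using d by (simp add: rat_of_code_def ab zero_less_divide_iff)
      then have "1 / real (Suc b) \<le> of_int (int_decode a) / real (Suc b)"
        by (intro divide_right_mono) simp_all
      then show ?thesis by (simp add: rat_of_code_def ab of_rat_divide of_rat_add)
    qed
    finally show "\<exists>r. eval (Comp p [Pair_prog]) [list_encode v, d] r \<and>
        \<bar>freq y v - of_rat (rat_of_code r)\<bar> < of_rat (rat_of_code d)"
      using ev by blast
  qed
  then show ?thesis unfolding admits_computable_freqs_def using admits_freqs_y[OF freqs] by blast
qed

end


section \<open>Computing the starting index\<close>

text \<open>The list of keys has the order of the tables in \<open>transducer_code\<close>, with the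
  state as the major index, so positions of keys and values correspond.\<close>

definition lookup :: "nat list \<Rightarrow> nat list \<Rightarrow> nat list \<Rightarrow> nat \<Rightarrow> nat \<Rightarrow> nat" where
  "lookup qs as vals q a =
     nth0 vals (length (takeWhile (\<lambda>k. k \<noteq> (q, a)) (concat (map (\<lambda>q. map (\<lambda>a. (q, a)) as) qs))))"

lemma nth0_takeWhile:
  "k \<in> set keys \<Longrightarrow> nth0 (map f keys) (length (takeWhile (\<lambda>k'. k' \<noteq> k) keys)) = f k"
proof (induction keys)
  case (Cons k' keys)
  then show ?case by (cases "k' = k") (auto simp: nth0_def)
qed simp

lemma lookup:
  assumes "q \<in> set qs" "a \<in> set as"
  shows "lookup qs as (concat (map (\<lambda>q. map (\<lambda>a. f q a) as) qs)) q a = f q a"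
proof -
  let ?keys = "concat (map (\<lambda>q. map (\<lambda>a. (q, a)) as) qs)"
  have "concat (map (\<lambda>q. map (\<lambda>a. f q a) as) qs) = map (\<lambda>k. f (fst k) (snd k)) ?keys"
    by (simp add: map_concat o_def)
  moreover have "(q, a) \<in> set ?keys" using assms by auto
  ultimately show ?thesis
    using nth0_takeWhile[of "(q, a)" ?keys "\<lambda>k. f (fst k) (snd k)"] by (simp add: lookup_def)
qed

lemma computable_lookup [computable_intros]:
  assumes "computable qs" "computable as" "computable vals" "computable q" "computable a"
  shows "computable (\<lambda>t. lookup (qs t) (as t) (vals t) (q t) (a t))"
proof -
  note compose_fst = assms[THEN computable_compose[OF _ computable_fst[OF computable_id]]]
  show ?thesis unfolding lookup_def
    by (intro computable_intros compose_fst assms)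
qed

definition decode_transducer :: "nat \<Rightarrow> (nat, nat, nat) transducer" where
  "decode_transducer c =
     (let L = list_decode c; qs = list_decode (nth0 L 0); as = list_decode (nth0 L 2) in
      \<lparr>states = set qs, initial = nth0 L 1, in_alph = set as, out_alph = set (list_decode (nth0 L 3)),
       out_fun = \<lambda>q a. list_decode (lookup qs as (list_decode (nth0 L 4)) q a),
       trans_fun = \<lambda>q a. lookup qs as (list_decode (nth0 L 5)) q a\<rparr>)"

lemma agree_decode_transducer:
  assumes "wf_transducer A"
  shows "agree A (decode_transducer (transducer_code A))"
proof -
  have "set (sorted_list_of_set (states A)) = states A" "set (sorted_list_of_set (in_alph A)) = in_alph A"
    using assms by (simp_all add: wf_transducer_def)
  then show ?thesis
    by (auto simp: agree_def decode_transducer_def transducer_code_def Let_def nth0_def lookup)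
qed

lemma computable_decode_transducer:
  assumes "computable c"
  shows "computable (\<lambda>a. initial (decode_transducer (c a)))"
    and "computable (\<lambda>t. trans_fun (decode_transducer (c (fst t))) (fst (snd t)) (snd (snd t)))"
    and "computable (\<lambda>t. out_fun (decode_transducer (c (fst t))) (fst (snd t)) (snd (snd t)))"
  unfolding decode_transducer_def Let_def
  by (simp, intro computable_intros assms computable_compose[OF assms])+

section \<open>Certificates of synchronization\<close>

text \<open>A certificate consists of a valid list of evaluation steps, a prefix \<open>X\<close> of the input word,
  the position \<open>i\<close> and length \<open>l\<close> of a synchronizing factor, and the values at \<open>l\<close> and
  \<open>r1 + l\<close> of the return function.\<close>

type_synonym certificate =
  "(nat \<times> nat list \<times> nat) list \<times> nat list \<times> nat \<times> nat \<times> nat \<times> nat"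

definition certifies :: "nat \<times> nat \<times> nat \<Rightarrow> certificate \<Rightarrow> bool" where
  "certifies a c \<longleftrightarrow>
     (let B = decode_transducer (fst a); pw = fst (snd a); pr = snd (snd a);
          E = fst c; X = fst (snd c); i = fst (snd (snd c)); l = fst (snd (snd (snd c)));
          r1 = fst (snd (snd (snd (snd c)))); r2 = snd (snd (snd (snd (snd c))))
      in valid E \<and> (pr, [l], r1) \<in> set E \<and> (pr, [r1 + l], r2) \<in> set E \<and>
         (\<forall>k<length X. (pw, [k], nth0 X k) \<in> set E) \<and>
         r2 + r1 + l \<le> length X \<and> i + l \<le> length X \<and>
         (\<forall>j<r2 + r1. take l (drop j X) = take l (drop i X) \<longrightarrow>
            trans_word B (take (j + l) X) (initial B) = trans_word B (take (i + l) X) (initial B)))"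

definition start_index :: "nat \<times> nat \<times> nat \<Rightarrow> certificate \<Rightarrow> nat" where
  "start_index a c =
     (let B = decode_transducer (fst a); X = fst (snd c);
          i = fst (snd (snd c)); l = fst (snd (snd (snd c)))
      in length (outs B (initial B) (take (i + l) X)))"

lemma computable_certifies: "computable (\<lambda>t. certifies (fst t) (snd t))"
  unfolding certifies_def Let_def
  by (intro computable_intros computable_trans_word computable_decode_transducer)

lemma computable_start_index: "computable (\<lambda>t. start_index (fst t) (snd t))"
  unfolding start_index_def Let_def
  by (intro computable_intros computable_outs computable_decode_transducer)

lemma certifies_iff:
  assumes A: "wf_transducer A" "range x \<subseteq> in_alph A" and X: "X = x [0 \<rightarrow> length X]"
  shows "certifies (transducer_code A, pw, pr) (E, X, i, l, r1, r2) \<longleftrightarrow>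
     valid E \<and> (pr, [l], r1) \<in> set E \<and> (pr, [r1 + l], r2) \<in> set E \<and>
     (\<forall>k<length X. (pw, [k], nth0 X k) \<in> set E) \<and> r2 + r1 + l \<le> length X \<and> i + l \<le> length X \<and>
     (\<forall>j<r2 + r1. x [j \<rightarrow> j + l] = x [i \<rightarrow> i + l] \<longrightarrow> run A x (j + l) = run A x (i + l))"
    (is "_ \<longleftrightarrow> ?R")
    and "i + l \<le> length X \<Longrightarrow> start_index (transducer_code A, pw, pr) (E, X, i, l, r1, r2) = out_length A x (i + l)"
proof -
  let ?B = "decode_transducer (transducer_code A)"
  have B: "run ?B x n = run A x n" "out_prefix ?B x n = out_prefix A x n" for n
    using run_agree[OF agree_decode_transducer] out_prefix_agree[OF agree_decode_transducer] A by blast+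
  obtain L where L: "X = x [0 \<rightarrow> L]" "length X = L" using X by blast
  have take: "take n X = x [0 \<rightarrow> n]" if "n \<le> L" for n using that by (simp add: L min_def)
  have sub: "take l (drop j X) = x [j \<rightarrow> j + l]" if "j + l \<le> L" for j using that by (simp add: L min_def add.commute)
  have tw: "trans_word ?B (take n X) (initial ?B) = run A x n" if "n \<le> L" for n
    using run_add[of ?B x 0 n] B(1)[of n] take[OF that] by simp
  have "(\<forall>j<r2 + r1. take l (drop j X) = take l (drop i X) \<longrightarrow>
        trans_word ?B (take (j + l) X) (initial ?B) = trans_word ?B (take (i + l) X) (initial ?B)) \<longleftrightarrow>
     (\<forall>j<r2 + r1. x [j \<rightarrow> j + l] = x [i \<rightarrow> i + l] \<longrightarrow> run A x (j + l) = run A x (i + l))"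
    if "r2 + r1 + l \<le> L" "i + l \<le> L"
    using that sub tw by (intro all_cong) simp
  then show "certifies (transducer_code A, pw, pr) (E, X, i, l, r1, r2) \<longleftrightarrow> ?R"
    unfolding certifies_def Let_def fst_conv snd_conv L(2) by blast
  show "start_index (transducer_code A, pw, pr) (E, X, i, l, r1, r2) = out_length A x (i + l)"
    if "i + l \<le> length X"
    using that take[of "i + l"] B(2)[of "i + l"] by (simp add: start_index_def Let_def out_prefix_eq L(2))
qed

text \<open>By \<open>eval_deterministic\<close> the claimed letters and return values are the true
  ones, so \<open>synced_criterion\<close> applies to whatever factor the certificate names.\<close>

lemma certifies_sound:
  assumes A: "wf_transducer A" "range x \<subseteq> in_alph A" and ur: "uniformly_recurrent x"
    and pw: "computes pw x" and pr: "computes pr (max_return x)"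
    and c: "certifies (transducer_code A, prog_code pw, prog_code pr) c"
  obtains i l where "synced A x i l"
    "start_index (transducer_code A, prog_code pw, prog_code pr) c = out_length A x (i + l)"
proof -
  obtain E X i l r1 r2 where c_eq: "c = (E, X, i, l, r1, r2)" by (metis prod.collapse)
  have E: "valid E" "\<forall>k<length X. (prog_code pw, [k], nth0 X k) \<in> set E"
    using c by (simp_all add: c_eq certifies_def Let_def)
  have "nth0 X k = x k" if "k < length X" for k
    using valid_sound[OF E(1) E(2)[rule_format, OF that]] pw[unfolded computes_def, rule_format, of k]
    by (rule eval_deterministic)
  then have X: "X = x [0 \<rightarrow> length X]" by (intro nth_equalityI) (simp_all add: nth0_def)
  note iff = certifies_iff(1)[OF A X, THEN iffD1, OF c[unfolded c_eq]]
  have return: "r = max_return x n" if "(prog_code pr, [n], r) \<in> set E" for r n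
    using valid_sound[OF E(1) that] pr[unfolded computes_def, rule_format, of n] by (rule eval_deterministic)
  have r1: "r1 = max_return x l" and r2: "r2 = max_return x (r1 + l)"
    using iff by (blast intro: return)+
  have fin: "finite (range x)"
    using A(2) by (rule finite_subset) (use A(1) in \<open>simp add: wf_transducer_def\<close>)
  have gap: "gap_bound x (x [j \<rightarrow> j + n]) (max_return x n)" for j n
    using gap_bound_max_return[OF ur fin factor_subsequence[of x j n]] by simp
  have "synced A x i l"
    by (rule synced_criterion[of x i l r1 r2]) (use iff gap r1 r2 in auto)
  moreover have "start_index (transducer_code A, prog_code pw, prog_code pr) c = out_length A x (i + l)"
    unfolding c_eq using iff by (intro certifies_iff(2)[OF A X]) blast
  ultimately show ?thesis by (rule that)
qed

text \<open>Guarantees that the search for a certificate ends: a synchronizing factor exists, and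
  finitely many evaluations document the values its check needs.\<close>

lemma certifies_complete:
  assumes A: "wf_transducer A" "range x \<subseteq> in_alph A" and cf: "counter_free A"
    and pw: "computes pw x" and pr: "computes pr (max_return x)"
  shows "\<exists>c. certifies (transducer_code A, prog_code pw, prog_code pr) c"
proof -
  obtain i l where synced: "synced A x i l" using synced_exists[OF A(1) cf A(2)] by blast
  define r1 r2 where "r1 = max_return x l" and "r2 = max_return x (r1 + l)"
  define L where "L = r2 + r1 + l + i"
  let ?X = "x [0 \<rightarrow> L]"
  define S where "S = {(pr, [l], r1), (pr, [r1 + l], r2)} \<union> (\<lambda>k. (pw, [k], x k)) ` {..<L}"
  have "eval p xs z" if "(p, xs, z) \<in> S" for p xs z
    using that pw pr by (auto simp: S_def computes_def r1_def r2_def)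
  moreover have "finite S" by (simp add: S_def)
  ultimately obtain E where E: "valid E" "\<And>p xs z. (p, xs, z) \<in> S \<Longrightarrow> (prog_code p, xs, z) \<in> set E"
    using finite_evals_valid[of S] by blast
  have "certifies (transducer_code A, prog_code pw, prog_code pr) (E, ?X, i, l, r1, r2)"
    unfolding certifies_iff(1)[OF A, of ?X, simplified]
  proof (intro conjI allI impI)
    show "(prog_code pr, [l], r1) \<in> set E" "(prog_code pr, [r1 + l], r2) \<in> set E"
      by (intro E(2); simp add: S_def)+
    show "(prog_code pw, [k], nth0 ?X k) \<in> set E" if "k < L" for k
      using that by (intro E(2)) (simp add: S_def nth0_def)
    show "run A x (j + l) = run A x (i + l)" if "x [j \<rightarrow> j + l] = x [i \<rightarrow> i + l]" for j
    proof -
      have "occurs_at x (x [i \<rightarrow> i + l]) j" using that by (simp add: occurs_at_def)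
      then show ?thesis using synced unfolding synced_def by blast
    qed
  qed (use E(1) in \<open>simp_all add: L_def\<close>)
  then show ?thesis ..
qed

text \<open>The search may find a certificate other than the one assumed, so the index computed is
  that of some certificate.\<close>

lemma eval_start_index:
  obtains p where "\<And>tc pw pr pf c. certifies (tc, pw, pr) c \<Longrightarrow>
    \<exists>c. certifies (tc, pw, pr) c \<and> eval p [tc, pw, pr, pf] (start_index (tc, pw, pr) c)"
proof -
  obtain ps where ps: "\<And>a c. certifies a c \<Longrightarrow> \<exists>c. eval ps [enc a] (enc c) \<and> certifies a c"
    using computable_search[OF computable_certifies] by blast
  obtain pi where pi: "\<And>a c. eval pi [enc (a, c)] (start_index a c)"
    using computable_start_index unfolding computable_def by (metis enc_nat_def fst_conv snd_conv)
  let ?args = "Comp Pair_prog [Proj 0, Comp Pair_prog [Proj 1, Proj 2]]"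
  let ?p = "Comp pi [Comp Pair_prog [?args, Comp ps [?args]]]"
  have args: "eval ?args [tc, pw, pr, pf] (enc (tc, pw, pr))" for tc pw pr pf :: nat
    unfolding enc_prod_def enc_nat_def
    by (rule eval_Comp2[OF eval_Proj eval_Comp2[OF eval_Proj eval_Proj eval_Pair_prog] eval_Pair_prog, simplified]) auto
  show ?thesis
  proof (rule that[of ?p])
    fix tc pw pr pf c assume "certifies (tc, pw, pr) c"
    then obtain c where c: "eval ps [enc (tc, pw, pr)] (enc c)" "certifies (tc, pw, pr) c" using ps by blast
    have "eval Pair_prog [enc (tc, pw, pr), enc c] (enc ((tc, pw, pr), c))"
      using eval_Pair_prog by (simp add: enc_prod_def)
    then have "eval (Comp Pair_prog [?args, Comp ps [?args]]) [tc, pw, pr, pf] (enc ((tc, pw, pr), c))"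
      by (rule eval_Comp2[OF args eval_Comp1[OF args c(1)]])
    then have "eval ?p [tc, pw, pr, pf] (start_index (tc, pw, pr) c)" using pi by (rule eval_Comp1)
    then show "\<exists>c. certifies (tc, pw, pr) c \<and> eval ?p [tc, pw, pr, pf] (start_index (tc, pw, pr) c)"
      using c(2) by blast
  qed
qed

lemma effective_suffix:
  fixes A :: "(nat, nat, nat) transducer"
  assumes A: "wf_transducer A" "range x \<subseteq> in_alph A"
    and x: "uniformly_recurrent x" "admits_freqs x" "output_infinite A x"
    and p: "computes p_word x" "computes p_return (max_return x)" "computes_freqs p_freq x"
    and synced: "synced A x i l"
  defines "y \<equiv> suffix (out_length A x (i + l)) (output_word A x)"
  shows "effectively_uniformly_recurrent y" "admits_computable_freqs y"
proof -
  \<comment> \<open>Tabulation makes the transition and output functions computable without changing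
    the run on \<open>x\<close>.\<close>
  let ?B = "tabulate A"
  note agree = agree_tabulate[of A] A
  have "range x \<subseteq> in_alph ?B" using A(2) by (simp add: tabulate_def)
  moreover have "output_infinite ?B x" "synced ?B x i l"
    using x(3) synced by (simp_all add: output_infinite_def out_prefix_agree[OF agree] synced_def run_agree[OF agree])
  ultimately interpret effective_synced_run ?B x i l p_freq
    using wf_tabulate[OF A(1)] computable_tabulate[OF A(1)] x p
    by unfold_locales (simp_all add: computes_iff[symmetric], blast+)
  have "y = suffix (out_length ?B x (i + l)) (output_word ?B x)"
    by (simp add: y_def out_prefix_agree[OF agree] output_word_agree[OF agree])
  then show "effectively_uniformly_recurrent y" "admits_computable_freqs y"
    using effectively_uniformly_recurrent_y admits_computable_freqs_y by simp_all
qed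

theorem theorem5p5:
  shows
    "(\<forall>(A :: ('q, 'a, 'b) transducer) (x :: 'a word).
        wf_transducer A \<and> counter_free A \<and> range x \<subseteq> in_alph A \<and>
        uniformly_recurrent x \<and> admits_freqs x \<and> output_infinite A x \<longrightarrow>
        (\<exists>s. let y = suffix s (output_word A x) in
             uniformly_recurrent y \<and> admits_freqs y))
     \<and>
     (\<exists>start_prog :: prog.
        \<forall>(A :: (nat, nat, nat) transducer) (x :: nat word) p_word p_return p_freq.
          wf_transducer A \<and> counter_free A \<and> range x \<subseteq> in_alph A \<and>
          uniformly_recurrent x \<and> admits_freqs x \<and> output_infinite A x \<and>
          computes p_word x \<and> computes p_return (max_return x) \<and> computes_freqs p_freq x \<longrightarrow>
          (\<exists>s. eval start_prog
                 [transducer_code A, prog_code p_word, prog_code p_return, prog_code p_freq] s \<and>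
               (let y = suffix s (output_word A x) in
                effectively_uniformly_recurrent y \<and> admits_computable_freqs y)))"
proof (intro conjI allI impI)
  fix A :: "('q, 'a, 'b) transducer" and x :: "'a word"
  assume hyp: "wf_transducer A \<and> counter_free A \<and> range x \<subseteq> in_alph A \<and>
    uniformly_recurrent x \<and> admits_freqs x \<and> output_infinite A x"
  then have "\<exists>i l. synced A x i l" by (intro synced_exists) simp_all
  then obtain i l where il: "synced A x i l" by blast
  interpret synced_run A x i l by unfold_locales (use hyp il in simp_all)
  show "\<exists>s. let y = suffix s (output_word A x) in uniformly_recurrent y \<and> admits_freqs y"
    using uniformly_recurrent_y admits_freqs_y hyp by (auto simp: Let_def)
next
  obtain p where p: "\<And>tc pw pr pf c. certifies (tc, pw, pr) c \<Longrightarrow>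
    \<exists>c. certifies (tc, pw, pr) c \<and> eval p [tc, pw, pr, pf] (start_index (tc, pw, pr) c)"
    using eval_start_index by blast
  show "\<exists>start_prog :: prog.
        \<forall>(A :: (nat, nat, nat) transducer) (x :: nat word) p_word p_return p_freq.
          wf_transducer A \<and> counter_free A \<and> range x \<subseteq> in_alph A \<and>
          uniformly_recurrent x \<and> admits_freqs x \<and> output_infinite A x \<and>
          computes p_word x \<and> computes p_return (max_return x) \<and> computes_freqs p_freq x \<longrightarrow>
          (\<exists>s. eval start_prog
                 [transducer_code A, prog_code p_word, prog_code p_return, prog_code p_freq] s \<and>
               (let y = suffix s (output_word A x) in
                effectively_uniformly_recurrent y \<and> admits_computable_freqs y))"
  proof (intro exI[of _ p] allI impI)
    fix A :: "(nat, nat, nat) transducer" and x :: "nat word" and p_word p_return p_freq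
    assume hyp: "wf_transducer A \<and> counter_free A \<and> range x \<subseteq> in_alph A \<and>
      uniformly_recurrent x \<and> admits_freqs x \<and> output_infinite A x \<and>
      computes p_word x \<and> computes p_return (max_return x) \<and> computes_freqs p_freq x"
    let ?a = "(transducer_code A, prog_code p_word, prog_code p_return)"
    obtain c where c: "certifies ?a c"
      "eval p [transducer_code A, prog_code p_word, prog_code p_return, prog_code p_freq] (start_index ?a c)"
      using p certifies_complete hyp by metis
    \<comment> \<open>This factor is the one named by the certificate found, so the computed index
      is where its synchronized output begins.\<close>
    obtain i l where il: "synced A x i l" "start_index ?a c = out_length A x (i + l)"
      using certifies_sound[OF _ _ _ _ _ c(1)] hyp by blast
    show "\<exists>s. eval p [transducer_code A, prog_code p_word, prog_code p_return, prog_code p_freq] s \<and>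
        (let y = suffix s (output_word A x) in
         effectively_uniformly_recurrent y \<and> admits_computable_freqs y)"
      using c(2) effective_suffix[OF _ _ _ _ _ _ _ _ il(1), of p_word p_return p_freq] hyp
      unfolding il(2) Let_def by blast
  qed
qed

end
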